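(* Let $M=\{(a,b)\in\mathbb{C}^2: 4a^3+27b^2\neq 0\}$. The A$_2$ Joyce structure on $M$ (defined in the context) is compatible with the restriction to $M\subset\mathbb{C}^2$ of the A$_2$ Frobenius structure. That is, there exist $\lambda,\mu\in\mathbb{C}^*$ such that for all vector fields $X,Y$ on $M$: (i) $g_{Joyce}(X,Y)=\lambda\cdot g_{Frob}(X,Y)$, where $g_{Joyce}$ is the Joyce form and $g_{Frob}$ the metric of the Frobenius structure; and (ii) $X\diamond_{Joyce}Y=\mu\cdot X\diamond_{Frob}Y$, where $\diamond_{Joyce}$ is the diamond product of the Joyce structure and $\diamond_{Frob}$ is the twisted multiplication of the Frobenius structure.
   Context: Periods. For $m=(a,b)\in M$ let $X_m$ be the compact elliptic curve completing $y^2=x^3+ax+b$, and $\Gamma_m=H_1(X_m,\mathbb{Z})\cong\mathbb{Z}^2$ with its intersection form $\langle-,-\rangle$; these form a local system over $M$ via the Gauss-Manin connection. Put $Z_m(\gamma)=\int_\gamma y\,dx$ for $\gamma\in\Gamma_m$. Let $(\gamma_1,\gamma_2)$ be a locally constant basis with $\langle\gamma_1,\gamma_2\rangle=1$ and $z_i=Z(\gamma_i)$; then $(z_1,z_2)$ are local co-ordinates on $M$. Write tangent vectors as $\sum_i\theta_i\,\partial/\partial z_i$; this gives local co-ordinates $(z_i,\theta_j)$ on the total space of the tangent bundle $T_M$. Equivalently a tangent vector $X\in T_{M,m}$ is identified with the homomorphism $\theta:\Gamma_m\to\mathbb{C}$, $\theta(\gamma)=X(Z(\gamma))$, $\theta_i=\theta(\gamma_i)$.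 Let $\pi:\mathbb{T}\to M$ be the bundle of tori with fibres $\operatorname{Hom}_{\mathbb{Z}}(\Gamma_m,\mathbb{C}^* )$; there is a map $T_M\to\mathbb{T}$, $\theta\mapsto\exp(\theta(-))$. The A$_2$ Joyce structure. Its data are: the flat torsion-free connection $\nabla$ on $T_M$ for which $z_1,z_2$ are flat co-ordinates; the bundle of lattices in $T_M^*$ spanned by $dz_1,dz_2$; the skew form with $\eta(dz_i,dz_j)=\langle\gamma_i,\gamma_j\rangle$; the Euler vector field $E=z_1\frac{\partial}{\partial z_1}+z_2\frac{\partial}{\partial z_2}=\frac{4a}{5}\frac{\partial}{\partial a}+\frac{6b}{5}\frac{\partial}{\partial b}$; and the Joyce function $J$ on $T_M$, the pullback along $T_M\to\mathbb{T}$ of the following meromorphic function $J$ on $\mathbb{T}$, which has no poles on the locus $\theta_1=\theta_2=0$. Let $$W=\{(a,b,q,p,r)\in\mathbb{C}^5: p^2=q^3+aq+b,\ 4a^3+27b^2\neq 0,\ p\neq 0\}.$$ There is an open embedding $\Theta:W\to\mathbb{T}$ over $M$ sending $(a,b,q,p,r)$ to the point $\xi\in\operatorname{Hom}(\Gamma_{(a,b)},\mathbb{C}^* )$ with $$\xi(\gamma)=\exp\Big(-\int_\gamma\Big(\frac{p}{x-q}+r\Big)\frac{dx}{2y}\Big),$$ where classes are represented by cycles avoiding the points over $x=q$ and anti-invariant under $y\mapsto -y$ (e.g. inverse images of paths in the $x$-plane joining zeroes of $x^3+ax+b$). The function $J$ is determined by $$\frac{1}{2\pi i}\Theta^*(J)=-\frac{1}{4\Delta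 p}\big(2ap^2+3p(3b-2aq)r+(6aq^2-9bq+4a^2)r^2-2apr^3\big),\qquad \Delta=4a^3+27b^2.$$ Joyce form and diamond product. The Joyce form is the symmetric bilinear form on $T_M$ with $g_{Joyce}\big(\frac{\partial}{\partial z_i},\frac{\partial}{\partial z_j}\big)=\sum_m z_m\frac{\partial^3J}{\partial\theta_i\partial\theta_j\partial\theta_m}\big|_{\theta=0}$. When it is non-degenerate (which is part of the meaning of compatibility, since it follows from (i)), the diamond product is the commutative operation on $T_M$ defined by $g_{Joyce}\big(\frac{\partial}{\partial z_i}\diamond_{Joyce}\frac{\partial}{\partial z_j},\frac{\partial}{\partial z_k}\big)=\frac{\partial^3J}{\partial\theta_i\partial\theta_j\partial\theta_k}\big|_{\theta=0}$. The A$_2$ Frobenius structure on $\mathbb{C}^2$ with co-ordinates $(a,b)$: metric $g_{Frob}=\frac13(da\otimes db+db\otimes da)$, identity $e=\frac{\partial}{\partial b}$, commutative product $*$ with unit $e$ and $\frac{\partial}{\partial a}*\frac{\partial}{\partial a}=-\frac{a}{3}\frac{\partial}{\partial b}$, and Euler vector field $E_{Frob}=\frac{2a}{3}\frac{\partial}{\partial a}+b\frac{\partial}{\partial b}$. On $M$ the operator $E_{Frob}*(-)$ is invertible, and the twisted multiplication $\diamond_{Frob}$ is defined by $E_{Frob}*(X\diamond_{Frob}Y)=X*Y$. *)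

theory Defs
  imports "HOL-Analysis.Analysis" "HOL-Homology.Homology"
begin

text \<open>Conventions. A point \<open>(a,b)\<close> of the base, a point \<open>(x,y)\<close> of an affine curve, a tangent
  vector \<open>u\<^sub>a \<partial>/\<partial>a + u\<^sub>b \<partial>/\<partial>b\<close> and a fibre co-ordinate \<open>(\<theta>\<^sub>1,\<theta>\<^sub>2)\<close> are all elements of
  \<^typ>\<open>complex^2\<close>.\<close>

section \<open>Holomorphic and meromorphic maps of several variables\<close>

text \<open>The first two arguments are the complex scalar multiplications of the source and of the
  target (product types such as \<^typ>\<open>complex^2 \<times> complex^2\<close> carry no library one). The
  definition is meant for open \<open>S\<close>.\<close>

definition holomorphic_map ::
    "(complex \<Rightarrow> 'a \<Rightarrow> 'a::real_normed_vector) \<Rightarrow> (complex \<Rightarrow> 'b \<Rightarrow> 'b::real_normed_vector)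
      \<Rightarrow> ('a \<Rightarrow> 'b) \<Rightarrow> 'a set \<Rightarrow> bool" where
  "holomorphic_map sa sb f S \<longleftrightarrow>
     (\<forall>z\<in>S. \<exists>f'. (f has_derivative f') (at z) \<and> (\<forall>c v. f' (sa c v) = sb c (f' v)))"

definition scale_pair :: "complex \<Rightarrow> (complex^2) \<times> (complex^2) \<Rightarrow> (complex^2) \<times> (complex^2)" where
  "scale_pair c v = (c *s fst v, c *s snd v)"

abbreviation holomorphic4 :: "((complex^2) \<times> (complex^2) \<Rightarrow> complex) \<Rightarrow> ((complex^2) \<times> (complex^2)) set \<Rightarrow> bool" where
  "holomorphic4 \<equiv> holomorphic_map scale_pair (*)"

text \<open>Locally a quotient of holomorphic functions, with denominator not vanishing on any non-empty
  open set. The values of the total function \<open>f\<close> where the denominator vanishes are not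
  constrained.\<close>

definition meromorphic4 :: "((complex^2) \<times> (complex^2) \<Rightarrow> complex) \<Rightarrow> ((complex^2) \<times> (complex^2)) set \<Rightarrow> bool" where
  "meromorphic4 f S \<longleftrightarrow>
     (\<forall>z\<in>S. \<exists>N g h. open N \<and> z \<in> N \<and> N \<subseteq> S \<and> holomorphic4 g N \<and> holomorphic4 h N \<and>
        interior {w \<in> N. h w = 0} = {} \<and> (\<forall>w\<in>N. h w \<noteq> 0 \<longrightarrow> f w = g w / h w))"

definition pderiv_at :: "'n::finite \<Rightarrow> (complex^'n \<Rightarrow> complex) \<Rightarrow> complex^'n \<Rightarrow> complex" where
  "pderiv_at i f v = deriv (\<lambda>t. f (v + axis i t)) 0"

section \<open>The family of elliptic curves\<close>

definition disc :: "complex^2 \<Rightarrow> complex" where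
  "disc m = 4 * (m$1)^3 + 27 * (m$2)^2"

definition base :: "(complex^2) set" where
  "base = {m. disc m \<noteq> 0}"

definition affine_curve :: "complex^2 \<Rightarrow> (complex^2) set" where
  "affine_curve m = {P. (P$2)^2 = (P$1)^3 + m$1 * P$1 + m$2}"

text \<open>The smooth projective model adds a single point \<open>None\<close> at infinity, so as a topological
  space it is the one-point compactification of the affine curve.\<close>

definition elliptic_curve :: "complex^2 \<Rightarrow> (complex^2) option topology" where
  "elliptic_curve m = Alexandroff_compactification (top_of_set (affine_curve m))"

abbreviation Gam :: "complex^2 \<Rightarrow> (complex^2) option chain set monoid" where
  "Gam m \<equiv> homology_group 1 (elliptic_curve m)"

definition curve_loop :: "complex^2 \<Rightarrow> (real \<Rightarrow> complex^2) \<Rightarrow> bool" where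
  "curve_loop m g \<longleftrightarrow> valid_path g \<and> pathfinish g = pathstart g \<and> path_image g \<subseteq> affine_curve m"

text \<open>A loop as a singular 1-simplex; \<open>u 1\<close> is the second barycentric co-ordinate.\<close>

definition loop_chain :: "(real \<Rightarrow> complex^2) \<Rightarrow> (complex^2) option chain" where
  "loop_chain g = frag_of (restrict (\<lambda>u. Some (g (u 1))) (standard_simplex 1))"

text \<open>Cycles are formal integer combinations of loops.\<close>

definition cycle_class :: "complex^2 \<Rightarrow> ((real \<Rightarrow> complex^2) \<Rightarrow>\<^sub>0 int) \<Rightarrow> (complex^2) option chain set" where
  "cycle_class m c = homologous_rel_set 1 (elliptic_curve m) {} (frag_extend loop_chain c)"

definition loop_class :: "complex^2 \<Rightarrow> (real \<Rightarrow> complex^2) \<Rightarrow> (complex^2) option chain set" where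
  "loop_class m g = cycle_class m (frag_of g)"

text \<open>The integral of \<open>f(x,y) dx\<close>. For \<open>f = k/(2y)\<close> the one-form \<open>dx/(2y)\<close> is regular at
  the branch points; on a path the integrand \<open>k x'/(2y)\<close> differs from that of the regular expression
  \<open>k dy/(3x\<^sup>2+a)\<close> only on a null set of parameters (where \<open>y = 0\<close>).\<close>

definition curve_integral :: "(complex^2 \<Rightarrow> complex) \<Rightarrow> (real \<Rightarrow> complex^2) \<Rightarrow> complex" where
  "curve_integral f g =
     integral {0..1} (\<lambda>t. f (g t) * vector_derivative (\<lambda>s. g s $ 1) (at t within {0..1}))"

definition cycle_integral :: "(complex^2 \<Rightarrow> complex) \<Rightarrow> ((real \<Rightarrow> complex^2) \<Rightarrow>\<^sub>0 int) \<Rightarrow> complex" where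
  "cycle_integral f c =
     (\<Sum>g\<in>Poly_Mapping.keys c. of_int (Poly_Mapping.lookup c g) * curve_integral f g)"

text \<open>Anti-invariance under \<open>y \<mapsto> -y\<close>: the involution reverses the loop. The inverse image of a
  path joining two zeroes of \<open>x\<^sup>3+ax+b\<close>, traversed out on one sheet and back on the other, is
  such a loop.\<close>

definition anti_invariant :: "(real \<Rightarrow> complex^2) \<Rightarrow> bool" where
  "anti_invariant g \<longleftrightarrow>
     (\<forall>t\<in>{0..1}. reversepath g t $ 1 = g t $ 1 \<and> reversepath g t $ 2 = - (g t $ 2))"

subsection \<open>The intersection form\<close>

text \<open>The tangent line of the curve is a complex line, so for \<open>v = c u\<close> in it the pair \<open>(u,v)\<close> is
  positively oriented iff \<open>Im c > 0\<close>, i.e. iff \<open>Im (cnj u\<^sub>1 v\<^sub>1 + cnj u\<^sub>2 v\<^sub>2) > 0\<close>.\<close>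

definition orient :: "complex^2 \<Rightarrow> complex^2 \<Rightarrow> real" where
  "orient u v = Im (cnj (u$1) * v$1 + cnj (u$2) * v$2)"

definition crossings :: "(real \<Rightarrow> complex^2) \<Rightarrow> (real \<Rightarrow> complex^2) \<Rightarrow> (real \<times> real) set" where
  "crossings g h = {(s,t). s \<in> {0..1} \<and> t \<in> {0..1} \<and> g s = h t}"

definition transversal :: "(real \<Rightarrow> complex^2) \<Rightarrow> (real \<Rightarrow> complex^2) \<Rightarrow> bool" where
  "transversal g h \<longleftrightarrow> finite (crossings g h) \<and>
     (\<forall>(s,t)\<in>crossings g h. s \<in> {0<..<1} \<and> t \<in> {0<..<1} \<and>
        g differentiable (at s) \<and> h differentiable (at t) \<and>
        orient (vector_derivative g (at s)) (vector_derivative h (at t)) \<noteq> 0)"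

text \<open>\<open>intersection_number m \<gamma> \<gamma>' n\<close> says that \<open>\<langle>\<gamma>,\<gamma>'\<rangle> = n\<close>: the signed number of crossings of
  transversal representatives.\<close>

definition intersection_number ::
    "complex^2 \<Rightarrow> (complex^2) option chain set \<Rightarrow> (complex^2) option chain set \<Rightarrow> int \<Rightarrow> bool" where
  "intersection_number m \<gamma> \<gamma>' n \<longleftrightarrow>
     (\<exists>g h. curve_loop m g \<and> curve_loop m h \<and> loop_class m g = \<gamma> \<and> loop_class m h = \<gamma>' \<and>
        transversal g h \<and>
        of_int n = (\<Sum>(s,t)\<in>crossings g h.
          sgn (orient (vector_derivative g (at s)) (vector_derivative h (at t)))))"

subsection \<open>Locally constant bases of homology and period co-ordinates\<close>

text \<open>A locally constant (Gauss-Manin flat) section of the homology local system, given by loops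
  moving with the parameter: \<open>C\<^sup>1\<close> in the loop variable, holomorphic in the parameter.\<close>

definition loop_family :: "(complex^2) set \<Rightarrow> (complex^2 \<Rightarrow> real \<Rightarrow> complex^2) \<Rightarrow> bool" where
  "loop_family U c \<longleftrightarrow>
     (\<forall>m\<in>U. curve_loop m (c m)) \<and>
     (\<forall>t\<in>{0..1}. holomorphic_map (*s) (*s) (\<lambda>m. c m t) U) \<and>
     continuous_on (U \<times> {0..1}) (\<lambda>(m,t). c m t) \<and>
     (\<exists>c'. continuous_on (U \<times> {0..1}) (\<lambda>(m,t). c' m t) \<and>
        (\<forall>m\<in>U. \<forall>t\<in>{0..1}. (c m has_vector_derivative c' m t) (at t within {0..1})))"

text \<open>\<open>c 1\<close>, \<open>c 2\<close> represent a locally constant basis \<open>(\<gamma>\<^sub>1,\<gamma>\<^sub>2)\<close> with \<open>\<langle>\<gamma>\<^sub>1,\<gamma>\<^sub>2\<rangle> = 1\<close>. Taking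
  the representatives to be anti-invariant does not restrict the classes: near each point of the
  base every flat section is carried by such loops.\<close>

definition period_frame :: "(complex^2) set \<Rightarrow> (2 \<Rightarrow> complex^2 \<Rightarrow> real \<Rightarrow> complex^2) \<Rightarrow> bool" where
  "period_frame U c \<longleftrightarrow> open U \<and> U \<subseteq> base \<and>
     (\<forall>i. loop_family U (c i)) \<and>
     (\<forall>m\<in>U. \<forall>i. anti_invariant (c i m)) \<and>
     (\<forall>m\<in>U. (\<forall>i. loop_class m (c i m) \<in> carrier (Gam m)) \<and>
        (\<forall>\<gamma>\<in>carrier (Gam m). \<exists>!n :: int^2.
           \<gamma> = (loop_class m (c 1 m) [^]\<^bsub>Gam m\<^esub> n$1) \<otimes>\<^bsub>Gam m\<^esub> (loop_class m (c 2 m) [^]\<^bsub>Gam m\<^esub> n$2)) \<and>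
        intersection_number m (loop_class m (c 1 m)) (loop_class m (c 2 m)) 1)"

text \<open>\<open>z\<^sub>i = Z(\<gamma>\<^sub>i)\<close>, and the components \<open>X(z\<^sub>i)\<close> of a tangent vector \<open>X = \<Sum>\<^sub>i X(z\<^sub>i) \<partial>/\<partial>z\<^sub>i\<close>.\<close>

definition period :: "(2 \<Rightarrow> complex^2 \<Rightarrow> real \<Rightarrow> complex^2) \<Rightarrow> 2 \<Rightarrow> complex^2 \<Rightarrow> complex" where
  "period c i m = curve_integral (\<lambda>P. P$2) (c i m)"

definition dperiod :: "(2 \<Rightarrow> complex^2 \<Rightarrow> real \<Rightarrow> complex^2) \<Rightarrow> 2 \<Rightarrow> complex^2 \<Rightarrow> complex^2 \<Rightarrow> complex" where
  "dperiod c i m X = (\<Sum>k\<in>UNIV. X$k * pderiv_at k (period c i) m)"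

section \<open>The bundle of tori and the Joyce function\<close>

definition Cstar :: "complex monoid" where
  "Cstar = \<lparr>carrier = - {0}, monoid.mult = (*), one = 1\<rparr>"

definition torus :: "complex^2 \<Rightarrow> ((complex^2) option chain set \<Rightarrow> complex) set" where
  "torus m = hom (Gam m) Cstar \<inter> extensional (carrier (Gam m))"

text \<open>The map from the tangent bundle to the bundle of tori, \<open>\<theta> \<mapsto> exp(\<theta>(-))\<close>, in the co-ordinates
  \<open>\<theta>\<^sub>i = \<theta>(\<gamma>\<^sub>i)\<close>.\<close>

definition torus_point ::
    "(2 \<Rightarrow> complex^2 \<Rightarrow> real \<Rightarrow> complex^2) \<Rightarrow> complex^2 \<Rightarrow> complex^2 \<Rightarrow> (complex^2) option chain set \<Rightarrow> complex" where
  "torus_point c m \<theta> = (THE \<xi>. \<xi> \<in> torus m \<and> (\<forall>i. \<xi> (loop_class m (c i m)) = exp (\<theta>$i)))"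

definition W_space :: "(complex \<times> complex \<times> complex \<times> complex \<times> complex) set" where
  "W_space = {(a,b,q,p,r). p^2 = q^3 + a*q + b \<and> 4*a^3 + 27*b^2 \<noteq> 0 \<and> p \<noteq> 0}"

text \<open>The graph of the embedding \<open>\<Theta>\<close>: \<open>Theta (a,b,q,p,r) \<xi>\<close> says that \<open>(a,b,q,p,r)\<close> is sent to the
  point \<open>\<xi>\<close> of the fibre over \<open>(a,b)\<close>. The one-form has residues \<open>\<plusminus>1/2\<close> at the points over
  \<open>x = q\<close>, and anti-invariance makes \<open>exp(-\<integral>)\<close> independent of the representative.
  The representatives lie in the affine curve: anti-invariant cycles through the point at
  infinity could change the sign.\<close>

definition Theta ::
    "complex \<times> complex \<times> complex \<times> complex \<times> complex \<Rightarrow> ((complex^2) option chain set \<Rightarrow> complex) \<Rightarrow> bool" where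
  "Theta w \<xi> \<longleftrightarrow> (case w of (a,b,q,p,r) \<Rightarrow>
     let m = vector [a,b] in
     \<xi> \<in> torus m \<and>
     (\<forall>\<gamma>\<in>carrier (Gam m). \<exists>c.
        (\<forall>g\<in>Poly_Mapping.keys c. curve_loop m g \<and> anti_invariant g \<and> (\<forall>P\<in>path_image g. P$1 \<noteq> q)) \<and>
        cycle_class m c = \<gamma> \<and>
        \<xi> \<gamma> = exp (- cycle_integral (\<lambda>P. (p / (P$1 - q) + r) / (2 * P$2)) c)))"

text \<open>\<open>J m \<xi>\<close> is the value at the point \<open>\<xi>\<close> of the torus over \<open>m\<close>. Meromorphy and the absence of
  poles are expressed in the local co-ordinates \<open>(m,\<theta>)\<close>; since the map from the tangent bundle to
  the bundle of tori is a local isomorphism, this is the same as on the bundle of tori.\<close>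

definition A2_Joyce_function ::
    "(complex^2 \<Rightarrow> ((complex^2) option chain set \<Rightarrow> complex) \<Rightarrow> complex) \<Rightarrow> bool" where
  "A2_Joyce_function J \<longleftrightarrow>
     (\<forall>U c. period_frame U c \<longrightarrow>
        meromorphic4 (\<lambda>(m,\<theta>). J m (torus_point c m \<theta>)) (U \<times> UNIV) \<and>
        (\<forall>m\<in>U. \<exists>N. open N \<and> (m,0) \<in> N \<and> N \<subseteq> U \<times> UNIV \<and>
           holomorphic4 (\<lambda>(m,\<theta>). J m (torus_point c m \<theta>)) N)) \<and>
     (\<forall>a b q p r \<xi>. (a,b,q,p,r) \<in> W_space \<longrightarrow> Theta (a,b,q,p,r) \<xi> \<longrightarrow>
        1 / (2 * of_real pi * \<i>) * J (vector [a,b]) \<xi> =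
          - (1 / (4 * (4*a^3 + 27*b^2) * p)) *
            (2*a*p^2 + 3*p*(3*b - 2*a*q)*r + (6*a*q^2 - 9*b*q + 4*a^2)*r^2 - 2*a*p*r^3))"

section \<open>Joyce form and diamond product\<close>

text \<open>\<open>\<partial>\<^sup>3J/\<partial>\<theta>\<^sub>i\<partial>\<theta>\<^sub>j\<partial>\<theta>\<^sub>k\<close> at \<open>\<theta> = 0\<close>.\<close>

definition J3 ::
    "(complex^2 \<Rightarrow> ((complex^2) option chain set \<Rightarrow> complex) \<Rightarrow> complex)
      \<Rightarrow> (2 \<Rightarrow> complex^2 \<Rightarrow> real \<Rightarrow> complex^2) \<Rightarrow> complex^2 \<Rightarrow> 2 \<Rightarrow> 2 \<Rightarrow> 2 \<Rightarrow> complex" where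
  "J3 J c m i j k =
     pderiv_at i (pderiv_at j (pderiv_at k (\<lambda>\<theta>. J m (torus_point c m \<theta>)))) 0"

text \<open>The bilinear extension of the formula for \<open>g(\<partial>/\<partial>z\<^sub>i, \<partial>/\<partial>z\<^sub>j)\<close>.\<close>

definition g_Joyce ::
    "(complex^2 \<Rightarrow> ((complex^2) option chain set \<Rightarrow> complex) \<Rightarrow> complex)
      \<Rightarrow> (2 \<Rightarrow> complex^2 \<Rightarrow> real \<Rightarrow> complex^2) \<Rightarrow> complex^2 \<Rightarrow> complex^2 \<Rightarrow> complex^2 \<Rightarrow> complex" where
  "g_Joyce J c m X Y =
     (\<Sum>i\<in>UNIV. \<Sum>j\<in>UNIV. dperiod c i m X * dperiod c j m Y *
        (\<Sum>k\<in>UNIV. period c k m * J3 J c m i j k))"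

definition g_Joyce_nondegenerate ::
    "(complex^2 \<Rightarrow> ((complex^2) option chain set \<Rightarrow> complex) \<Rightarrow> complex)
      \<Rightarrow> (2 \<Rightarrow> complex^2 \<Rightarrow> real \<Rightarrow> complex^2) \<Rightarrow> complex^2 \<Rightarrow> bool" where
  "g_Joyce_nondegenerate J c m \<longleftrightarrow> (\<forall>X. (\<forall>Y. g_Joyce J c m X Y = 0) \<longrightarrow> X = 0)"

text \<open>Again the multilinear extension of the formula given on the vectors \<open>\<partial>/\<partial>z\<^sub>i\<close>; meaningful when
  the Joyce form is non-degenerate.\<close>

definition diamond_Joyce ::
    "(complex^2 \<Rightarrow> ((complex^2) option chain set \<Rightarrow> complex) \<Rightarrow> complex)
      \<Rightarrow> (2 \<Rightarrow> complex^2 \<Rightarrow> real \<Rightarrow> complex^2) \<Rightarrow> complex^2 \<Rightarrow> complex^2 \<Rightarrow> complex^2 \<Rightarrow> complex^2" where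
  "diamond_Joyce J c m X Y = (THE V. \<forall>T. g_Joyce J c m V T =
     (\<Sum>i\<in>UNIV. \<Sum>j\<in>UNIV. \<Sum>k\<in>UNIV.
        dperiod c i m X * dperiod c j m Y * dperiod c k m T * J3 J c m i j k))"

section \<open>The Frobenius structure\<close>

definition g_Frob :: "complex^2 \<Rightarrow> complex^2 \<Rightarrow> complex" where
  "g_Frob X Y = 1/3 * (X$1 * Y$2 + X$2 * Y$1)"

text \<open>The commutative bilinear product with unit \<open>\<partial>/\<partial>b\<close> and \<open>\<partial>/\<partial>a * \<partial>/\<partial>a = -(a/3) \<partial>/\<partial>b\<close>.\<close>

definition mult_Frob :: "complex^2 \<Rightarrow> complex^2 \<Rightarrow> complex^2 \<Rightarrow> complex^2" where
  "mult_Frob m X Y = vector [X$1 * Y$2 + X$2 * Y$1, X$2 * Y$2 - m$1 / 3 * (X$1 * Y$1)]"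

definition E_Frob :: "complex^2 \<Rightarrow> complex^2" where
  "E_Frob m = vector [2 * m$1 / 3, m$2]"

definition diamond_Frob :: "complex^2 \<Rightarrow> complex^2 \<Rightarrow> complex^2 \<Rightarrow> complex^2" where
  "diamond_Frob m X Y = (THE V. mult_Frob m (E_Frob m) V = mult_Frob m X Y)"

definition vector_field :: "(complex^2 \<Rightarrow> complex^2) \<Rightarrow> bool" where
  "vector_field X \<longleftrightarrow> holomorphic_map (*s) (*s) X base"

end

theory Submission
  imports Defs "HOL-Complex_Analysis.Cauchy_Integral_Formula"
begin

text \<open>Near the zero section of the bundle of tori the point \<open>(q,p)\<close> of the elliptic curve tends to
  infinity. Put \<open>q = t\<^sup>-\<^sup>2\<close>, \<open>p = s t\<^sup>-\<^sup>3\<close> with \<open>s\<^sup>2 = 1 + at\<^sup>4 + bt\<^sup>6\<close>, and \<open>r = p/q - kt\<close>.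
  Let \<open>\<omega>\<^sub>i\<close> and \<open>\<eta>\<^sub>i\<close> be the integrals of \<open>dx/2y\<close> and \<open>x dx/2y\<close> over \<open>\<gamma>\<^sub>i\<close>, that is,
  \<open>\<partial>z\<^sub>i/\<partial>b\<close> and \<open>\<partial>z\<^sub>i/\<partial>a\<close>. Expanding the form of the third kind in \<open>1/q\<close> gives
  \<open>\<theta>\<^sub>i = t (k\<omega>\<^sub>i + \<eta>\<^sub>i) - t\<^sup>3 (a/3)\<omega>\<^sub>i + O(t\<^sup>5)\<close>, whereas the formula for \<open>J\<close> becomes
  \<open>(2a\<^sup>2 + 9bk) t + (-2ab - 2a\<^sup>2k - 9bk\<^sup>2 + 2ak\<^sup>3) t\<^sup>3 + O(t\<^sup>5)\<close> up to a constant factor. Comparing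
  coefficients for all \<open>k\<close> shows that the cubic part of \<open>J\<close> at a tangent vector
  \<open>u\<^sub>a \<partial>/\<partial>a + u\<^sub>b \<partial>/\<partial>b\<close> is \<open>-2\<pi>i/(4\<Delta>)\<close> times
  \<open>ab u\<^sub>a\<^sup>3 - 2a\<^sup>2 u\<^sub>a\<^sup>2u\<^sub>b - 9b u\<^sub>au\<^sub>b\<^sup>2 + 2a u\<^sub>b\<^sup>3\<close>.
  Contraction with the Euler field \<open>z\<^sub>i = (4a/5) \<eta>\<^sub>i + (6b/5) \<omega>\<^sub>i\<close> gives the claims. Since everything is
  expressed through \<open>\<omega>\<close> and \<open>\<eta>\<close>, their linear independence is never needed.\<close>

section \<open>Holomorphic functions of several variables\<close>

lemma linear_axis: "linear (axis i :: complex \<Rightarrow> complex^'n::finite)"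
  by (rule linearI) (auto simp: vec_eq_iff axis_def)

text \<open>A complex-homogeneous derivative is determined by its values on the unit vectors
  \<open>axis i 1\<close>. Composing with the inclusion of an axis identifies these values with the
  one-variable derivatives \<open>pderiv_at\<close>.\<close>

lemma has_derivative_partials:
  fixes f :: "complex^'n::finite \<Rightarrow> complex"
  assumes "holomorphic_map (*s) (*) f S" "z \<in> S"
  shows "(f has_derivative (\<lambda>v. \<Sum>i\<in>UNIV. v$i * pderiv_at i f z)) (at z)"
proof -
  obtain f' where f': "(f has_derivative f') (at z)" and hom: "\<And>c v. f' (c *s v) = c * f' v"
    using assms unfolding holomorphic_map_def by blast
  have lin: "linear f'"
    using f' has_derivative_linear by blast
  have p: "pderiv_at i f z = f' (axis i 1)" for i
  proof -
    have "((\<lambda>t. z + axis i t) has_derivative axis i) (at (0::complex))"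
      using bounded_linear_imp_has_derivative[OF linear_axis[unfolded linear_conv_bounded_linear]]
      by (auto intro!: derivative_eq_intros)
    moreover have "(f has_derivative f') (at (z + axis i (0::complex)))"
      using f' by (simp add: linear_0[OF linear_axis])
    ultimately have "((\<lambda>t. f (z + axis i t)) has_derivative (\<lambda>t. f' (axis i t))) (at 0)"
      by (rule has_derivative_compose)
    moreover have "(\<lambda>t. f' (axis i t)) = (*) (f' (axis i 1))"
    proof (rule ext)
      fix t
      have "axis i t = t *s (axis i 1 :: complex^'n)"
        by (auto simp: vec_eq_iff axis_def)
      then show "f' (axis i t) = f' (axis i 1) * t" by (metis hom mult.commute)
    qed
    ultimately have "((\<lambda>t. f (z + axis i t)) has_field_derivative f' (axis i 1)) (at 0)"
      unfolding has_field_derivative_def by metis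
    then show ?thesis
      unfolding pderiv_at_def by (rule DERIV_imp_deriv)
  qed
  have "f' v = (\<Sum>i\<in>UNIV. v$i * pderiv_at i f z)" for v
  proof -
    have "f' v = f' (\<Sum>i\<in>UNIV. v$i *s axis i 1)"
      by (simp add: basis_expansion)
    also have "\<dots> = (\<Sum>i\<in>UNIV. v$i * pderiv_at i f z)"
      by (simp add: linear_sum[OF lin] hom p)
    finally show ?thesis .
  qed
  then have "f' = (\<lambda>v. \<Sum>i\<in>UNIV. v$i * pderiv_at i f z)" by blast
  with f' show ?thesis by simp
qed

lemma holomorphic_map_imp_continuous_on:
  fixes f :: "complex^'n::finite \<Rightarrow> complex"
  assumes "holomorphic_map (*s) (*) f S"
  shows "continuous_on S f"
  using has_derivative_partials[OF assms]
  by (meson continuous_at_imp_continuous_on has_derivative_continuous)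

text \<open>The chain rule, with the hypotheses on the curve put componentwise so that one-variable
  rules settle them for polynomial curves. The proof reassembles the curve as a sum of axis
  vectors.\<close>

lemma DERIV_along_curve:
  fixes f :: "complex^'n::finite \<Rightarrow> complex"
  assumes f: "holomorphic_map (*s) (*) f S" "\<gamma> t \<in> S"
    and \<gamma>: "\<And>i. ((\<lambda>t. \<gamma> t $ i) has_field_derivative d i) (at t)"
  shows "((\<lambda>t. f (\<gamma> t)) has_field_derivative (\<Sum>i\<in>UNIV. d i * pderiv_at i f (\<gamma> t))) (at t)"
proof -
  have bl: "bounded_linear (axis i :: complex \<Rightarrow> complex^'n)" for i
    using linear_axis by (simp add: linear_conv_bounded_linear)
  have "(\<lambda>t. \<Sum>i\<in>UNIV. axis i (\<gamma> t $ i)) = \<gamma>"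
    by (auto simp: vec_eq_iff axis_def fun_eq_iff)
  moreover have "((\<lambda>t. \<Sum>i\<in>UNIV. axis i (\<gamma> t $ i)) has_derivative
      (\<lambda>h. \<Sum>i\<in>UNIV. axis i (d i * h))) (at t)"
    by (intro has_derivative_sum bounded_linear.has_derivative[OF bl])
       (use \<gamma> in \<open>auto simp: has_field_derivative_def\<close>)
  moreover have "(\<Sum>i\<in>UNIV. axis i (d i * h)) = (\<chi> i. d i * h)" for h
    by (auto simp: vec_eq_iff axis_def)
  ultimately have "(\<gamma> has_derivative (\<lambda>h. \<chi> i. d i * h)) (at t)"
    by simp
  from has_derivative_compose[OF this has_derivative_partials[OF f]]
  have "((\<lambda>t. f (\<gamma> t)) has_derivative (\<lambda>h. \<Sum>i\<in>UNIV. d i * h * pderiv_at i f (\<gamma> t))) (at t)"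
    by simp
  moreover have "(\<Sum>i\<in>UNIV. d i * h * pderiv_at i f (\<gamma> t)) = (\<Sum>i\<in>UNIV. d i * pderiv_at i f (\<gamma> t)) * h" for h
    by (simp add: sum_distrib_left mult_ac)
  ultimately show ?thesis
    by (simp add: has_field_derivative_def)
qed

lemma DERIV_axis:
  fixes f :: "complex^'n::finite \<Rightarrow> complex"
  assumes f: "holomorphic_map (*s) (*) f S" "z + axis i t \<in> S"
  shows "((\<lambda>t. f (z + axis i t)) has_field_derivative pderiv_at i f (z + axis i t)) (at t)"
proof -
  have "((\<lambda>t. (z + axis i t) $ j) has_field_derivative (if j = i then 1 else 0)) (at t)" for j
    by (cases "j = i") (auto simp: axis_def intro!: derivative_eq_intros)
  from DERIV_along_curve[of f S "\<lambda>t. z + axis i t", OF f this]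
  show ?thesis by (simp add: if_distrib[of "\<lambda>x. x * _"] sum.delta cong: if_cong)
qed

text \<open>Differentiating this formula under the integral sign shows that partial derivatives of
  holomorphic functions are holomorphic and commute.\<close>

lemma pderiv_at_Cauchy:
  fixes f :: "complex^'n::finite \<Rightarrow> complex"
  assumes f: "holomorphic_map (*s) (*) f S" and "open S" and r: "r > 0"
    and sub: "\<And>\<zeta>. norm \<zeta> \<le> r \<Longrightarrow> z + axis i \<zeta> \<in> S"
  shows "((\<lambda>t. f (z + axis i (of_real r * exp (2 * of_real pi * \<i> * of_real t)))
             / (of_real r * exp (2 * of_real pi * \<i> * of_real t)))
           has_integral pderiv_at i f z) {0..1}"
proof -
  let ?g = "\<lambda>\<zeta>. f (z + axis i \<zeta>)"
  have der: "(?g has_field_derivative pderiv_at i f (z + axis i \<zeta>)) (at \<zeta>)" if "norm \<zeta> \<le> r" for \<zeta>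
    by (rule DERIV_axis[OF f sub[OF that]])
  have cont: "continuous_on (cball 0 r) ?g"
    by (rule continuous_at_imp_continuous_on) (use DERIV_isCont[OF der] in simp)
  have hol: "?g holomorphic_on ball 0 r"
    by (rule holomorphic_onI)
       (metis der field_differentiable_at_within field_differentiable_def less_imp_le mem_ball_0)
  have 0: "0 \<in> ball (0::complex) r" using r by simp
  have int: "((\<lambda>u. ?g u / (u - 0)^2) has_contour_integral (2 * pi * \<i>) * deriv ?g 0) (circlepath 0 r)"
    using Cauchy_derivative_integral_circlepath(1)[OF cont hol 0]
      Cauchy_contour_integral_circlepath_2[OF cont hol 0]
    by (metis has_contour_integral_integral)
  then have "((\<lambda>t. ?g (circlepath 0 r t) / (circlepath 0 r t)^2
      * vector_derivative (circlepath 0 r) (at t within {0..1})) has_integral (2 * pi * \<i>) * deriv ?g 0) {0..1}"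
    by (simp add: has_contour_integral_def)
  \<comment> \<open>Cauchy's kernel for a first derivative has a double pole; the velocity of the
    circle is \<open>2 * pi * \<i>\<close> times the position and cancels one factor.\<close>
  then have "((\<lambda>t. (2 * pi * \<i>) * (?g (circlepath 0 r t) / circlepath 0 r t))
      has_integral (2 * pi * \<i>) * deriv ?g 0) {0..1}"
  proof (rule has_integral_eq[rotated])
    fix t :: real assume "t \<in> {0..1}"
    then have "vector_derivative (circlepath 0 r) (at t within {0..1}) = 2 * pi * \<i> * circlepath 0 r t"
      by (simp add: vector_derivative_circlepath01) (simp add: circlepath)
    moreover have "circlepath 0 r t \<noteq> 0"
      using r by (simp add: circlepath)
    ultimately show "?g (circlepath 0 r t) / (circlepath 0 r t)^2 * vector_derivative (circlepath 0 r) (at t within {0..1})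
        = (2 * pi * \<i>) * (?g (circlepath 0 r t) / circlepath 0 r t)"
      by (simp add: power2_eq_square)
  qed
  from has_integral_mult_right[OF this, of "1 / (2 * pi * \<i>)"]
  show ?thesis by (simp add: pderiv_at_def circlepath)
qed


lemma norm_axis: "norm (axis i x :: complex^'n::finite) = norm x"
proof -
  have "(\<Sum>j\<in>UNIV. (cmod (if j = i then x else 0))\<^sup>2) = (\<Sum>j\<in>UNIV. if j = i then (cmod x)\<^sup>2 else 0)"
    by (rule sum.cong) auto
  then show ?thesis
    by (simp add: norm_vec_def L2_set_def axis_def)
qed

text \<open>Joint continuity in the centre and the angle is what both the continuity of the Cauchy
  integral in its centre and differentiation under the integral sign require.\<close>

lemma Cauchy_kernel_continuous:
  fixes f :: "complex^'n::finite \<Rightarrow> complex"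
  assumes f: "continuous_on S f" and r: "r > 0"
    and sub: "\<And>z \<zeta>. z \<in> U \<Longrightarrow> norm \<zeta> \<le> r \<Longrightarrow> z + axis i \<zeta> \<in> S"
  shows "continuous_on (U \<times> T)
    (\<lambda>(z, t). f (z + axis i (of_real r * exp (2 * of_real pi * \<i> * of_real t)))
             / (of_real r * exp (2 * of_real pi * \<i> * of_real t)))"
proof -
  have bl: "bounded_linear (axis i :: complex \<Rightarrow> complex^'n)"
    using linear_axis by (simp add: linear_conv_bounded_linear)
  have "continuous_on (U \<times> T)
      (\<lambda>p. f (fst p + axis i (of_real r * exp (2 * of_real pi * \<i> * of_real (snd p)))))"
    by (rule continuous_on_compose2[OF f])
       (use r in \<open>auto intro!: continuous_intros bounded_linear.continuous_on[OF bl] sub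
          simp: norm_mult\<close>)
  then show ?thesis
    unfolding case_prod_unfold using r by (intro continuous_intros) auto
qed

text \<open>\<open>holomorphic_map\<close> only asks for a derivative at each point. Continuity of
  the partials comes from Cauchy's formula over a circle whose radius is the same for all centres
  near a given point.\<close>

lemma continuous_on_pderiv_at:
  fixes f :: "complex^'n::finite \<Rightarrow> complex"
  assumes f: "holomorphic_map (*s) (*) f S" and S: "open S"
  shows "continuous_on S (pderiv_at i f)"
proof (rule continuous_at_imp_continuous_on, rule ballI)
  fix z0 assume "z0 \<in> S"
  then obtain e where e: "e > 0" "ball z0 e \<subseteq> S"
    using S openE by blast
  define r where "r = e / 2"
  have r: "r > 0" using e by (simp add: r_def)
  have sub: "z + axis i \<zeta> \<in> S" if "z \<in> ball z0 r" "norm \<zeta> \<le> r" for z \<zeta>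
  proof -
    have "norm (z0 - (z + axis i \<zeta>)) \<le> norm (z0 - z) + norm (axis i \<zeta> :: complex^'n)"
      by (metis diff_diff_eq norm_triangle_ineq4)
    then show ?thesis
      using that e by (intro subsetD[OF e(2)]) (auto simp: dist_norm norm_axis r_def)
  qed
  have "continuous_on (ball z0 r) (\<lambda>z. integral (cbox 0 1)
      (\<lambda>t. f (z + axis i (of_real r * exp (2 * of_real pi * \<i> * of_real t)))
             / (of_real r * exp (2 * of_real pi * \<i> * of_real t))))"
    by (rule integral_continuous_on_param)
       (rule Cauchy_kernel_continuous[OF holomorphic_map_imp_continuous_on[OF f] r sub])
  moreover have "integral (cbox 0 1)
      (\<lambda>t. f (z + axis i (of_real r * exp (2 * of_real pi * \<i> * of_real t)))
             / (of_real r * exp (2 * of_real pi * \<i> * of_real t))) = pderiv_at i f z"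
    if "z \<in> ball z0 r" for z
    using pderiv_at_Cauchy[OF f S r sub[OF that]] by (simp add: integral_unique)
  ultimately have "continuous_on (ball z0 r) (pderiv_at i f)"
    by (rule continuous_on_eq)
  then show "isCont (pderiv_at i f) z0"
    using r by (simp add: continuous_on_eq_continuous_at)
qed

text \<open>Both claims rest on one computation: the derivative of the Cauchy integral for
  \<open>pderiv_at i f\<close> in direction \<open>j\<close> is the same integral with
  \<open>pderiv_at j f\<close> in place of \<open>f\<close>.\<close>

lemma
  fixes f :: "complex^'n::finite \<Rightarrow> complex"
  assumes f: "holomorphic_map (*s) (*) f S" and S: "open S"
  shows holomorphic_map_pderiv_at: "holomorphic_map (*s) (*) (pderiv_at i f) S"
    and pderiv_at_commute: "z \<in> S \<Longrightarrow> pderiv_at j (pderiv_at i f) z = pderiv_at i (pderiv_at j f) z"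
proof -
  have main: "\<exists>f' r. r > 0 \<and> (\<forall>\<zeta>. norm \<zeta> \<le> r \<longrightarrow> z0 + axis i \<zeta> \<in> S) \<and>
     (pderiv_at i f has_derivative f') (at z0) \<and> (\<forall>c v. f' (c *s v) = c * f' v) \<and>
     (\<forall>j. f' (axis j 1) = integral {0..1}
       (\<lambda>t. pderiv_at j f (z0 + axis i (of_real r * exp (2 * of_real pi * \<i> * of_real t)))
             / (of_real r * exp (2 * of_real pi * \<i> * of_real t))))"
    if "z0 \<in> S" for z0 i
  proof -
    obtain e where e: "e > 0" "ball z0 e \<subseteq> S"
      using S openE \<open>z0 \<in> S\<close> by blast
    define r where "r = e / 2"
    define U where "U = ball z0 r"
    have r: "r > 0" using e by (simp add: r_def)
    have sub: "z + axis i \<zeta> \<in> S" if "z \<in> U" "norm \<zeta> \<le> r" for z \<zeta>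
    proof -
      have "norm (z0 - (z + axis i \<zeta>)) \<le> norm (z0 - z) + norm (axis i \<zeta> :: complex^'n)"
        by (metis diff_diff_eq norm_triangle_ineq4)
      then show ?thesis
        using that e by (intro subsetD[OF e(2)]) (auto simp: dist_norm norm_axis r_def U_def)
    qed
    define w where "w = (\<lambda>t::real. of_real r * exp (2 * of_real pi * \<i> * of_real t) :: complex)"
    have nw: "norm (w t) \<le> r" and w0: "w t \<noteq> 0" for t
      using r by (auto simp: w_def norm_mult)
    \<comment> \<open>\<open>leibniz_rule\<close> takes the derivative of the integrand as a bounded
      linear operator, so the partials are assembled into \<open>fx\<close> from the co-ordinate
      projections \<open>P j\<close>.\<close>
    define P where "P = (\<lambda>j. Blinfun (\<lambda>v::complex^'n. v $ j))"
    have P: "blinfun_apply (P j) v = v $ j" for j v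
      unfolding P_def by (simp add: bounded_linear_Blinfun_apply bounded_linear_vec_nth)
    define fx where "fx = (\<lambda>z t. \<Sum>j\<in>UNIV.
      blinfun_mult_right (pderiv_at j f (z + axis i (w t)) / w t) o\<^sub>L P j)"
    have fx: "blinfun_apply (fx z t) v = (\<Sum>j\<in>UNIV. pderiv_at j f (z + axis i (w t)) / w t * v $ j)" for z t v
      unfolding fx_def by (simp add: blinfun.sum_left P)
    have ker: "continuous_on (U \<times> cbox 0 1) (\<lambda>(z, t). g (z + axis i (w t)) / w t)"
      if "continuous_on S g" for g
      unfolding w_def by (rule Cauchy_kernel_continuous[OF that r sub])
    have cfx: "continuous_on (U \<times> cbox 0 1) (\<lambda>(z, t). fx z t)"
      unfolding fx_def case_prod_unfold
      by (intro continuous_on_sum bounded_bilinear.continuous_on[OF bounded_bilinear_blinfun_compose]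
            bounded_linear.continuous_on[OF bounded_linear_blinfun_mult_right] continuous_on_const
            ker[unfolded case_prod_unfold] continuous_on_pderiv_at[OF f S])
    have zU: "z0 \<in> U" and U: "open U" "convex U" using r by (auto simp: U_def)
    have "((\<lambda>z. integral (cbox 0 1) (\<lambda>t. f (z + axis i (w t)) / w t)) has_derivative
        integral (cbox 0 1) (fx z0)) (at z0 within U)"
    proof (rule leibniz_rule[OF _ _ cfx zU U(2)])
      fix z t assume "z \<in> U"
      have "((\<lambda>z. z + axis i (w t)) has_derivative (\<lambda>v. v)) (at z)"
        by (auto intro!: derivative_eq_intros)
      from has_derivative_compose[OF this has_derivative_partials[OF f sub[OF \<open>z \<in> U\<close> nw]]]
      have "((\<lambda>z. f (z + axis i (w t)) / w t) has_derivative
          (\<lambda>v. (\<Sum>j\<in>UNIV. v $ j * pderiv_at j f (z + axis i (w t))) / w t)) (at z)"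
        using bounded_linear.has_derivative[OF bounded_linear_divide] by blast
      moreover have "blinfun_apply (fx z t)
          = (\<lambda>v. (\<Sum>j\<in>UNIV. v $ j * pderiv_at j f (z + axis i (w t))) / w t)"
        unfolding fx sum_divide_distrib by (intro ext sum.cong) auto
      ultimately show "((\<lambda>z. f (z + axis i (w t)) / w t) has_derivative blinfun_apply (fx z t)) (at z within U)"
        by (simp add: has_derivative_at_withinI)
    next
      fix z assume "z \<in> U"
      show "(\<lambda>t. f (z + axis i (w t)) / w t) integrable_on cbox 0 1"
        using pderiv_at_Cauchy[OF f S r sub[OF \<open>z \<in> U\<close>]]
        unfolding w_def by (simp add: has_integral_integrable)
    qed
    then have "((\<lambda>z. integral (cbox 0 1) (\<lambda>t. f (z + axis i (w t)) / w t)) has_derivative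
        integral (cbox 0 1) (fx z0)) (at z0)"
      unfolding at_within_open[OF zU U(1)] .
    then have 1: "(pderiv_at i f has_derivative integral (cbox 0 1) (fx z0)) (at z0)"
    proof (rule has_derivative_transform_within_open[OF _ U(1) zU])
      fix z assume "z \<in> U"
      show "integral (cbox 0 1) (\<lambda>t. f (z + axis i (w t)) / w t) = pderiv_at i f z"
        using pderiv_at_Cauchy[OF f S r sub[OF \<open>z \<in> U\<close>]]
        unfolding w_def by (simp add: integral_unique)
    qed
    have int: "fx z0 integrable_on cbox 0 1"
    proof (rule integrable_continuous)
      have "continuous_on (cbox 0 1) (\<lambda>t. (\<lambda>(z, t). fx z t) (z0, t))"
        by (rule continuous_on_compose2[OF cfx]) (use zU in \<open>auto intro!: continuous_intros\<close>)
      then show "continuous_on (cbox 0 1) (fx z0)" by simp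
    qed
    have app: "blinfun_apply (integral (cbox 0 1) (fx z0)) v
        = integral (cbox 0 1) (\<lambda>t. \<Sum>j\<in>UNIV. pderiv_at j f (z0 + axis i (w t)) / w t * v $ j)" for v
      using blinfun_apply_integral[OF int] by (simp only: fx)
    have 2: "blinfun_apply (integral (cbox 0 1) (fx z0)) (c *s v)
        = c * blinfun_apply (integral (cbox 0 1) (fx z0)) v" for c v
      unfolding app by (simp add: sum_distrib_left mult_ac flip: integral_mult_right)
    have 3: "blinfun_apply (integral (cbox 0 1) (fx z0)) (axis j 1)
       = integral {0..1} (\<lambda>t. pderiv_at j f (z0 + axis i (w t)) / w t)" for j
    proof -
      have "(\<Sum>k\<in>UNIV. pderiv_at k f (z0 + axis i (w t)) / w t * axis j 1 $ k)
          = pderiv_at j f (z0 + axis i (w t)) / w t" for t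
        by (simp add: axis_def if_distrib[of "\<lambda>x. _ * x"] cong: if_cong)
      then show ?thesis unfolding app by simp
    qed
    show ?thesis
      using r sub[OF zU] 1 2 3 unfolding w_def by blast
  qed
  show hol: "holomorphic_map (*s) (*) (pderiv_at i f) S" for i
    unfolding holomorphic_map_def using main by blast
  show "pderiv_at j (pderiv_at i f) z = pderiv_at i (pderiv_at j f) z" if z: "z \<in> S"
  proof -
    obtain f' r where r: "r > 0" and sub: "\<And>\<zeta>. norm \<zeta> \<le> r \<Longrightarrow> z + axis i \<zeta> \<in> S"
      and f': "(pderiv_at i f has_derivative f') (at z)" 
      and int: "f' (axis j 1) = integral {0..1}
       (\<lambda>t. pderiv_at j f (z + axis i (of_real r * exp (2 * of_real pi * \<i> * of_real t)))
             / (of_real r * exp (2 * of_real pi * \<i> * of_real t)))"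
      using main[OF z] by blast
    have "f' = (\<lambda>v. \<Sum>k\<in>UNIV. v$k * pderiv_at k (pderiv_at i f) z)"
      by (rule has_derivative_unique[OF f' has_derivative_partials[OF hol z]])
    then have "f' (axis j 1) = pderiv_at j (pderiv_at i f) z"
      by (simp add: axis_def if_distrib[of "\<lambda>x. x * _"] cong: if_cong)
    \<comment> \<open>The integral is also Cauchy's formula for the partial derivative of
      \<open>pderiv_at j f\<close>, which is holomorphic by the first claim.\<close>
    moreover have "f' (axis j 1) = pderiv_at i (pderiv_at j f) z"
      unfolding int by (rule integral_unique[OF pderiv_at_Cauchy[OF hol S r sub]])
    ultimately show ?thesis by simp
  qed
qed


text \<open>The continuous partials are bounded on a compact ball, which bounds the operator norm of
  the derivative. The estimate later compares the Joyce function at an exact point with its value at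
  a polynomial approximation of that point.\<close>

lemma holomorphic_map_locally_Lipschitz:
  fixes f :: "complex^'n::finite \<Rightarrow> complex"
  assumes f: "holomorphic_map (*s) (*) f S" and S: "open S" and z: "z \<in> S"
  obtains r K where "r > 0" "K \<ge> 0" "ball z r \<subseteq> S"
    "\<And>x y. x \<in> ball z r \<Longrightarrow> y \<in> ball z r \<Longrightarrow> norm (f x - f y) \<le> K * norm (x - y)"
proof -
  obtain r where r: "r > 0" "cball z r \<subseteq> S"
    using S z open_contains_cball by blast
  have "\<exists>B. \<forall>x\<in>cball z r. norm (pderiv_at i f x) \<le> B" for i
  proof -
    have "compact (pderiv_at i f ` cball z r)"
      by (intro compact_continuous_image continuous_on_subset[OF continuous_on_pderiv_at[OF f S] r(2)]) simp
    then show ?thesis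
      using compact_imp_bounded bounded_iff by (metis imageI)
  qed
  then obtain B where B: "\<And>i x. x \<in> cball z r \<Longrightarrow> norm (pderiv_at i f x) \<le> B i"
    by metis
  define K where "K = (\<Sum>i\<in>UNIV. B i)"
  have "norm (f x - f y) \<le> K * norm (x - y)" if xy: "x \<in> ball z r" "y \<in> ball z r" for x y
  proof (rule differentiable_bound[OF convex_ball _ _ xy])
    fix x assume x: "x \<in> ball z r"
    show "(f has_derivative (\<lambda>v. \<Sum>i\<in>UNIV. v$i * pderiv_at i f x)) (at x within ball z r)"
      by (rule has_derivative_at_withinI, rule has_derivative_partials[OF f])
         (use x r(2) in \<open>auto simp: subset_iff less_imp_le\<close>)
    show "onorm (\<lambda>v. \<Sum>i\<in>UNIV. v$i * pderiv_at i f x) \<le> K"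
    proof (rule onorm_le)
      fix v :: "complex^'n"
      have "norm (\<Sum>i\<in>UNIV. v$i * pderiv_at i f x) \<le> (\<Sum>i\<in>UNIV. norm v * B i)"
      proof (rule sum_norm_le)
        fix i :: 'n
        have "norm (pderiv_at i f x) \<le> B i" using B x by simp
        then show "norm (v$i * pderiv_at i f x) \<le> norm v * B i"
          unfolding norm_mult by (intro mult_mono Finite_Cartesian_Product.norm_nth_le) auto
      qed
      then show "norm (\<Sum>i\<in>UNIV. v$i * pderiv_at i f x) \<le> K * norm v"
        by (simp add: K_def sum_distrib_left mult.commute)
    qed
  qed
  moreover have "K \<ge> 0"
    unfolding K_def
  proof (rule sum_nonneg)
    fix i :: 'n
    have "norm (pderiv_at i f z) \<le> B i" using B r(1) by simp
    then show "0 \<le> B i" using norm_ge_zero order_trans by blast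
  qed
  moreover have "ball z r \<subseteq> S"
    using r(2) ball_subset_cball by blast
  ultimately show ?thesis
    using that r(1) by blast
qed

text \<open>Equality of mixed second partials holds on a whole neighbourhood, so it survives a
  further derivative. Together with the exchange of the two outer indices this gives full symmetry
  of third partials.\<close>

lemma pderiv_at_commute3:
  fixes f :: "complex^'n::finite \<Rightarrow> complex"
  assumes f: "holomorphic_map (*s) (*) f S" and S: "open S" "z \<in> S"
  shows "pderiv_at i (pderiv_at j (pderiv_at k f)) z = pderiv_at i (pderiv_at k (pderiv_at j f)) z"
  unfolding pderiv_at_def[of i]
proof (rule deriv_cong_ev)
  have "open ((\<lambda>t. z + axis i t) -` S)"
    by (intro open_vimage S continuous_intros linear_continuous_on)
       (use linear_axis in \<open>simp add: linear_conv_bounded_linear\<close>)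
  moreover have "0 \<in> (\<lambda>t. z + axis i t) -` S"
    using S by (simp add: linear_0[OF linear_axis])
  ultimately show "\<forall>\<^sub>F t in nhds 0. pderiv_at j (pderiv_at k f) (z + axis i t) = pderiv_at k (pderiv_at j f) (z + axis i t)"
    unfolding eventually_nhds using pderiv_at_commute[OF f S(1)] by fastforce
qed simp

section \<open>Taylor coefficients along a curve\<close>

text \<open>Cauchy's inequality on the circle of radius \<rho> bounds the k-th derivative by a
  constant times \<open>\<rho> ^ (n - k)\<close>, and \<rho> may tend to 0.\<close>

lemma derivs_0_of_bigo:
  fixes d :: "complex \<Rightarrow> complex"
  assumes hol: "d holomorphic_on ball 0 e" and e: "e > 0"
    and bd: "\<And>t. t \<noteq> 0 \<Longrightarrow> norm t < e \<Longrightarrow> norm (d t) \<le> K * norm t ^ n" and k: "k < n"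
  shows "(deriv ^^ k) d 0 = 0"
proof -
  have "norm ((deriv ^^ k) d 0) \<le> fact k * K * \<rho> ^ (n - k)" if \<rho>: "0 < \<rho>" "\<rho> < e" for \<rho>
  proof -
    have "norm ((deriv ^^ k) d 0) \<le> fact k * (K * \<rho> ^ n) / \<rho> ^ k"
    proof (rule Cauchy_inequality)
      show "d holomorphic_on ball 0 \<rho>"
        by (rule holomorphic_on_subset[OF hol]) (use \<rho> in auto)
      show "continuous_on (cball 0 \<rho>) d"
        by (rule holomorphic_on_imp_continuous_on[OF holomorphic_on_subset[OF hol]]) (use \<rho> in auto)
      show "norm (d x) \<le> K * \<rho> ^ n" if "norm (0 - x) = \<rho>" for x
        using bd[of x] that \<rho> by auto
    qed (use \<rho> in auto)
    also have "\<dots> = fact k * K * \<rho> ^ (n - k)"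
      using \<rho> k by (simp add: power_diff)
    finally show ?thesis .
  qed
  then have ev: "\<forall>\<^sub>F \<rho> in at_right 0. norm ((deriv ^^ k) d 0) \<le> fact k * K * \<rho> ^ (n - k)"
    using e by (auto simp: eventually_at_right_field)
  have "((\<lambda>\<rho>. fact k * K * \<rho> ^ (n - k)) \<longlongrightarrow> fact k * K * 0 ^ (n - k)) (at_right 0)"
    by (intro tendsto_intros)
  then have "norm ((deriv ^^ k) d 0) \<le> fact k * K * 0 ^ (n - k)"
    by (rule tendsto_lowerbound[OF _ ev]) simp
  moreover have "(0::real) ^ (n - k) = 0" using k by simp
  ultimately show ?thesis by simp
qed

text \<open>The curve has no quadratic term, so at \<open>t = 0\<close> the third-order chain rule
  has no term mixing second partials with \<open>w\<close>; the vector \<open>w\<close> enters only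
  through the gradient, with factor 3! = 6.\<close>

lemma derivs_along_cubic_curve:
  fixes f :: "complex^'n::finite \<Rightarrow> complex" and u w :: "complex^'n"
  assumes f: "holomorphic_map (*s) (*) f S" and S: "open S" "0 \<in> S"
  defines "g \<equiv> \<lambda>t. f (t *s u + t^3 *s w)"
  shows "\<exists>e>0. g holomorphic_on ball 0 e"
    and "deriv g 0 = (\<Sum>i\<in>UNIV. u$i * pderiv_at i f 0)"
    and "(deriv ^^ 3) g 0
      = (\<Sum>i\<in>UNIV. \<Sum>j\<in>UNIV. \<Sum>k\<in>UNIV. u$i * u$j * u$k * pderiv_at i (pderiv_at j (pderiv_at k f)) 0)
        + 6 * (\<Sum>i\<in>UNIV. w$i * pderiv_at i f 0)"
proof -
  define \<gamma> where "\<gamma> = (\<lambda>t. t *s u + t^3 *s w)"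
  define T where "T = \<gamma> -` S"
  define v where "v = (\<lambda>t i. u$i + 3 * t^2 * w$i)"
  have \<gamma>': "((\<lambda>t. \<gamma> t $ i) has_field_derivative v t i) (at t)" for i t
    unfolding \<gamma>_def v_def by (auto intro!: derivative_eq_intros)
  have "continuous_on UNIV \<gamma>"
    unfolding \<gamma>_def vector_scalar_mult_def by (intro continuous_intros)
  then have T: "open T"
    unfolding T_def using S(1) by (simp add: open_vimage)
  have 0: "0 \<in> T" "\<gamma> 0 = 0"
    using S(2) by (auto simp: T_def \<gamma>_def)
  note h1 = holomorphic_map_pderiv_at[OF f S(1)]
  note h2 = holomorphic_map_pderiv_at[OF h1 S(1)]
  have D: "((\<lambda>t. h (\<gamma> t)) has_field_derivative (\<Sum>i\<in>UNIV. v t i * pderiv_at i h (\<gamma> t))) (at t)"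
    if "holomorphic_map (*s) (*) h S" "t \<in> T" for h t
    by (rule DERIV_along_curve[OF that(1) _ \<gamma>']) (use that in \<open>simp add: T_def\<close>)
  have v': "((\<lambda>t. v t i) has_field_derivative 6 * t * w$i) (at t)" for i t
    unfolding v_def by (auto intro!: derivative_eq_intros)
  define g1 where "g1 = (\<lambda>t. \<Sum>i\<in>UNIV. v t i * pderiv_at i f (\<gamma> t))"
  define g2 where "g2 = (\<lambda>t. \<Sum>i\<in>UNIV. v t i * (\<Sum>j\<in>UNIV. v t j * pderiv_at j (pderiv_at i f) (\<gamma> t))
      + 6 * t * w$i * pderiv_at i f (\<gamma> t))"
  have g: "(g has_field_derivative g1 t) (at t)" if "t \<in> T" for t
    using D[OF f that] by (simp add: g_def g1_def \<gamma>_def)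
  have d1: "deriv g t = g1 t" if "t \<in> T" for t
    using g[OF that] by (rule DERIV_imp_deriv)
  have g1: "(g1 has_field_derivative g2 t) (at t)" if "t \<in> T" for t
    unfolding g1_def g2_def
    by (intro DERIV_sum DERIV_mult' D h1 that v')
  have d2: "deriv (deriv g) t = g2 t" if "t \<in> T" for t
    by (rule DERIV_imp_deriv, rule has_field_derivative_transform_within_open[OF g1[OF that] T that])
       (simp add: d1)
  have lin: "((\<lambda>t. 6 * t * c) has_field_derivative 6 * c) (at (t::complex))" for c t
    by (auto intro!: derivative_eq_intros)
  have "(g2 has_field_derivative
      (\<Sum>i\<in>UNIV. (v 0 i * (\<Sum>j\<in>UNIV. v 0 j * (\<Sum>k\<in>UNIV. v 0 k * pderiv_at k (pderiv_at j (pderiv_at i f)) (\<gamma> 0))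
           + 6 * 0 * w$j * pderiv_at j (pderiv_at i f) (\<gamma> 0))
          + 6 * 0 * w$i * (\<Sum>j\<in>UNIV. v 0 j * pderiv_at j (pderiv_at i f) (\<gamma> 0)))
         + (6 * 0 * w$i * (\<Sum>j\<in>UNIV. v 0 j * pderiv_at j (pderiv_at i f) (\<gamma> 0))
          + 6 * w$i * pderiv_at i f (\<gamma> 0)))) (at 0)"
    unfolding g2_def by (intro DERIV_sum DERIV_add DERIV_mult' D h1 h2 0 v' lin)
  then have "(g2 has_field_derivative
      (\<Sum>i\<in>UNIV. \<Sum>j\<in>UNIV. \<Sum>k\<in>UNIV. u$i * u$j * u$k * pderiv_at k (pderiv_at j (pderiv_at i f)) 0)
        + 6 * (\<Sum>i\<in>UNIV. w$i * pderiv_at i f 0)) (at 0)"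
    by (simp add: 0 v_def sum.distrib sum_distrib_left mult_ac)
  then have d3: "deriv (deriv (deriv g)) 0 =
      (\<Sum>i\<in>UNIV. \<Sum>j\<in>UNIV. \<Sum>k\<in>UNIV. u$i * u$j * u$k * pderiv_at k (pderiv_at j (pderiv_at i f)) 0)
        + 6 * (\<Sum>i\<in>UNIV. w$i * pderiv_at i f 0)"
    by (intro DERIV_imp_deriv, elim has_field_derivative_transform_within_open[OF _ T 0(1)])
       (simp add: d2)
  obtain e where "e > 0" "ball 0 e \<subseteq> T"
    using openE[OF T 0(1)] by blast
  moreover have "g holomorphic_on T"
    using g by (intro holomorphic_onI) (auto simp: field_differentiable_def intro: has_field_derivative_at_within)
  ultimately show "\<exists>e>0. g holomorphic_on ball 0 e"
    using holomorphic_on_subset by blast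
  show "deriv g 0 = (\<Sum>i\<in>UNIV. u$i * pderiv_at i f 0)"
    using d1[OF 0(1)] by (simp add: g1_def v_def 0)
  \<comment> \<open>Repeated differentiation lists the indices in reverse; adjacent transpositions
    restore the order used in \<open>J3\<close>.\<close>
  have "pderiv_at k (pderiv_at j (pderiv_at i f)) 0 = pderiv_at i (pderiv_at j (pderiv_at k f)) 0" for i j k
    using pderiv_at_commute3[OF f S, of k j i] pderiv_at_commute3[OF f S, of j i k]
      pderiv_at_commute[OF h1 S, of k j i] pderiv_at_commute[OF h1 S, of j i k] by simp
  then show "(deriv ^^ 3) g 0
      = (\<Sum>i\<in>UNIV. \<Sum>j\<in>UNIV. \<Sum>k\<in>UNIV. u$i * u$j * u$k * pderiv_at i (pderiv_at j (pderiv_at k f)) 0)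
        + 6 * (\<Sum>i\<in>UNIV. w$i * pderiv_at i f 0)"
    using d3 by (simp add: numeral_3_eq_3)
qed

section \<open>Integrals along loops on the curve\<close>

text \<open>The remainder in the derivative is divided by the norm of \<open>s - t\<close>;
  multiplying by the sign of \<open>s - t\<close> turns this into the signed difference
  quotient.\<close>

lemma has_vector_derivative_quotient:
  assumes "(f has_vector_derivative f') (at t)"
  shows "((\<lambda>s. (f s - f t) /\<^sub>R (s - t)) \<longlongrightarrow> f') (at t)"
proof (rule Lim_transform_eventually)
  have h: "((\<lambda>s. (f s - f t - (s - t) *\<^sub>R f') /\<^sub>R norm (s - t)) \<longlongrightarrow> 0) (at t)"
    using assms unfolding has_vector_derivative_def has_derivative_at_within
    by (simp add: divide_inverse mult_ac)
  have "((\<lambda>s. sgn (s - t) *\<^sub>R ((f s - f t - (s - t) *\<^sub>R f') /\<^sub>R norm (s - t))) \<longlongrightarrow> 0) (at t)"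
    by (rule Lim_null_comparison[OF _ tendsto_norm_zero[OF h]], rule always_eventually)
       (auto simp: sgn_real_def)
  from tendsto_add[OF this tendsto_const]
  show "((\<lambda>s. sgn (s - t) *\<^sub>R ((f s - f t - (s - t) *\<^sub>R f') /\<^sub>R norm (s - t)) + f') \<longlongrightarrow> f') (at t)"
    by simp
  show "\<forall>\<^sub>F s in at t. sgn (s - t) *\<^sub>R ((f s - f t - (s - t) *\<^sub>R f') /\<^sub>R norm (s - t)) + f' = (f s - f t) /\<^sub>R (s - t)"
  proof (rule eventually_at_filter[THEN iffD2], rule always_eventually, intro allI impI)
    fix s assume "s \<noteq> t"
    then have "sgn (s - t) * inverse (norm (s - t)) = inverse (s - t)"
      by (auto simp: sgn_real_def abs_real_def simp flip: inverse_minus_eq)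
    then have "sgn (s - t) *\<^sub>R ((f s - f t - (s - t) *\<^sub>R f') /\<^sub>R norm (s - t))
        = inverse (s - t) *\<^sub>R (f s - f t - (s - t) *\<^sub>R f')"
      by simp
    then show "sgn (s - t) *\<^sub>R ((f s - f t - (s - t) *\<^sub>R f') /\<^sub>R norm (s - t)) + f' = (f s - f t) /\<^sub>R (s - t)"
      using \<open>s \<noteq> t\<close> by (simp add: scaleR_diff_right)
  qed
qed

text \<open>A Bezout relation between the cubic and its derivative. Where the discriminant is
  nonzero they have no common root, so the affine curve is smooth, and the cofactors give a
  pole-free expression for dx/(2y).\<close>

lemma disc_Bezout:
  "disc m = (3 * x^2 + m$1) * (6 * m$1 * x^2 - 9 * m$2 * x + 4 * (m$1)^2)
            - (18 * m$1 * x - 27 * m$2) * (x^3 + m$1 * x + m$2)"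
  unfolding disc_def by (simp add: algebra_simps power2_eq_square power3_eq_cube)

text \<open>The velocity \<open>g'\<close> is a parameter because a \<open>loop_family\<close> comes
  with velocities that are continuous jointly in the base point and the loop parameter. At the ends
  of the interval it is a one-sided derivative.\<close>

locale smooth_curve_loop =
  fixes m :: "complex^2" and g g' :: "real \<Rightarrow> complex^2"
  assumes base: "m \<in> base"
    and on_curve: "t \<in> {0..1} \<Longrightarrow> g t \<in> affine_curve m"
    and closed: "g 1 = g 0"
    and deriv: "t \<in> {0..1} \<Longrightarrow> (g has_vector_derivative g' t) (at t within {0..1})"
    and cont': "continuous_on {0..1} g'"
begin

text \<open>The one-form \<open>dx/(2y)\<close> along the loop: multiplying it by
  \<open>(6ax\<^sup>2-9bx+4a\<^sup>2)(3x\<^sup>2+a) - (18ax-27b)(x\<^sup>3+ax+b) = \<Delta>\<close> and using \<open>2y dy = (3x\<^sup>2+a) dx\<close>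
  removes the denominator \<open>y\<close>.\<close>

definition nu :: "real \<Rightarrow> complex" where
  "nu t = ((6 * m$1 * (g t$1)^2 - 9 * m$2 * g t$1 + 4 * (m$1)^2) * g' t$2
            - (18 * m$1 * g t$1 - 27 * m$2) * g t$2 * g' t$1 / 2) / disc m"

definition omega :: complex where
  "omega = integral {0..1} nu"

definition eta :: complex where
  "eta = integral {0..1} (\<lambda>t. g t$1 * nu t)"

lemma Weierstrass: "t \<in> {0..1} \<Longrightarrow> (g t$2)^2 = (g t$1)^3 + m$1 * g t$1 + m$2"
  using on_curve by (simp add: affine_curve_def)

lemma deriv_component:
  "t \<in> {0..1} \<Longrightarrow> ((\<lambda>t. g t $ i) has_vector_derivative g' t $ i) (at t within {0..1})"
  by (rule bounded_linear.has_vector_derivative[OF bounded_linear_vec_nth deriv])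

lemma cont: "continuous_on {0..1} g"
  using deriv by (meson continuous_on_eq_continuous_within has_vector_derivative_continuous)

lemma tangent: 
  assumes t: "t \<in> {0..1}"
  shows "2 * g t$2 * g' t$2 = (3 * (g t$1)^2 + m$1) * g' t$1"
proof -
  have 1: "((\<lambda>t. (g t$2)^2) has_vector_derivative 2 * g t$2 * g' t$2) (at t within {0..1})"
    using deriv_component[OF t]
    by (auto intro!: derivative_eq_intros simp: power2_eq_square)
  have 2: "((\<lambda>t. (g t$1)^3 + m$1 * g t$1 + m$2) has_vector_derivative (3 * (g t$1)^2 + m$1) * g' t$1) (at t within {0..1})"
    using deriv_component[OF t]
    by (auto intro!: derivative_eq_intros simp: power2_eq_square power3_eq_cube algebra_simps)
  have "((\<lambda>t. (g t$2)^2) has_vector_derivative (3 * (g t$1)^2 + m$1) * g' t$1) (at t within {0..1})"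
    by (rule has_vector_derivative_transform[OF t _ 2]) (simp add: Weierstrass)
  then show ?thesis
    using vector_derivative_unique_within[OF _ 1] t by (simp add: trivial_limit_within islimpt_Icc)
qed

lemma disc_nonzero: "disc m \<noteq> 0"
  using base by (simp add: base_def)

text \<open>The two local expressions dx/(2y) and dy/(3x^2+a) of the invariant differential, cleared
  of denominators so that they hold at every point of the loop, branch points included.\<close>

lemma
  assumes t: "t \<in> {0..1}"
  shows nu_1: "g' t$1 = 2 * g t$2 * nu t"
    and nu_2: "g' t$2 = (3 * (g t$1)^2 + m$1) * nu t"
proof -
  let ?x = "g t$1" and ?y = "g t$2" and ?a = "m$1" and ?b = "m$2"
  have D: "disc m = (3 * ?x^2 + ?a) * (6*?a*?x^2 - 9*?b*?x + 4*?a^2) - (18*?a*?x - 27*?b) * ?y^2"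
    unfolding Weierstrass[OF t] by (rule disc_Bezout)
  have N: "disc m * nu t = (6*?a*?x^2 - 9*?b*?x + 4*?a^2) * g' t$2 - (18*?a*?x - 27*?b) * ?y * g' t$1 / 2"
    using disc_nonzero by (simp add: nu_def)
  \<comment> \<open>With \<open>A\<close>, \<open>B\<close> the Bezout cofactors and
    \<open>F\<close> the derivative of the cubic, the tangency relation makes both products
    multiples of \<open>F * A - B * y^2\<close>, which is the discriminant.\<close>
  have "2 * y * (A * y' - B * y * x' / 2) = (F * A - B * y^2) * x'
      \<and> F * (A * y' - B * y * x' / 2) = (F * A - B * y^2) * y'"
    if "2 * y * y' = F * x'" for y x' y' A B F :: complex
  proof -
    have "2 * y * (A * y' - B * y * x' / 2) = A * (2 * y * y') - B * y^2 * x'"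
      by (simp add: algebra_simps power2_eq_square)
    then have 1: "2 * y * (A * y' - B * y * x' / 2) = (F * A - B * y^2) * x'"
      unfolding that by (simp add: algebra_simps)
    have "F * (A * y' - B * y * x' / 2) = F * A * y' - B * y * (F * x') / 2"
      by (simp add: algebra_simps)
    then have "F * (A * y' - B * y * x' / 2) = (F * A - B * y^2) * y'"
      unfolding that[symmetric] by (simp add: algebra_simps power2_eq_square)
    with 1 show ?thesis by blast
  qed
  note * = this[OF tangent[OF t]]
  have "2 * ?y * (disc m * nu t) = disc m * g' t$1"
    unfolding N unfolding D using * by blast
  moreover have "(3 * ?x^2 + ?a) * (disc m * nu t) = disc m * g' t$2"
    unfolding N unfolding D using * by blast
  ultimately show "g' t$1 = 2 * g t$2 * nu t" "g' t$2 = (3 * (g t$1)^2 + m$1) * nu t"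
    using disc_nonzero by (simp_all add: mult.assoc)
qed

lemma cont_nu: "continuous_on {0..1} nu"
  unfolding nu_def[abs_def] using cont cont' disc_nonzero by (intro continuous_intros) auto

lemma branch_regular:
  assumes "t \<in> {0..1}" "g t$2 = 0"
  shows "3 * (g t$1)^2 + m$1 \<noteq> 0"
proof
  assume 0: "3 * (g t$1)^2 + m$1 = 0"
  have "disc m = 0"
    using 0 Weierstrass[OF assms(1)] assms(2) by (simp add: disc_Bezout[of m "g t$1"])
  with disc_nonzero show False by simp
qed

text \<open>A zero of \<open>g t$2\<close> with nonzero velocity is isolated, so there are only
  countably many. These are the only parameters at which the literal integrand of a form h dx/(2y)
  can differ from its regular version \<open>h (g t) * nu t\<close>.\<close>

lemma negligible_transversal_branch: "negligible {t \<in> {0..1}. g t$2 = 0 \<and> g' t$2 \<noteq> 0}"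
proof -
  define D where "D = {0<..<1} \<inter> {t. g' t$2 \<noteq> 0}"
  have c1: "continuous_on {0<..<1} (\<lambda>t. g t $ 2)" and c2: "continuous_on {0<..<1} (\<lambda>t. g' t $ 2)"
    using cont cont' by (auto intro!: continuous_intros elim: continuous_on_subset)
  have D: "open D"
    unfolding D_def using continuous_open_preimage[OF c2 open_greaterThanLessThan open_Compl[OF closed_singleton[of 0]]]
    by (simp add: vimage_def)
  have "{t. g t$2 = 0} sparse_in D"
    unfolding sparse_in_eventually_iff[OF D]
  proof
    fix t assume "t \<in> D"
    then have t: "t \<in> {0<..<1}" "g' t$2 \<noteq> 0" by (auto simp: D_def)
    have d: "((\<lambda>t. g t $ 2) has_vector_derivative g' t $ 2) (at t)"
      using deriv_component[of t 2] t(1) at_within_Icc_at[of 0 t 1] by (metis atLeastAtMost_iff greaterThanLessThan_iff less_imp_le)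
    show "\<forall>\<^sub>F s in at t. s \<notin> {t. g t$2 = 0}"
    proof (cases "g t $ 2 = 0")
      case True
      have "((\<lambda>s. (g s$2 - g t$2) /\<^sub>R (s - t)) \<longlongrightarrow> g' t$2) (at t)"
        by (rule has_vector_derivative_quotient[OF d])
      then have "\<forall>\<^sub>F s in at t. (g s$2 - g t$2) /\<^sub>R (s - t) \<noteq> 0"
        using t(2) by (rule tendsto_imp_eventually_ne)
      then show ?thesis
        by eventually_elim (use True in auto)
    next
      case False
      have "((\<lambda>s. g s$2) \<longlongrightarrow> g t$2) (at t)"
        using has_vector_derivative_continuous[OF d] by (simp add: continuous_at)
      then have "\<forall>\<^sub>F s in at t. g s$2 \<noteq> 0"
        using False by (rule tendsto_imp_eventually_ne)
      then show ?thesis by simp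
    qed
  qed
  then have "countable (D \<inter> {t. g t$2 = 0})"
    by (rule sparse_imp_countable[OF D])
  then have "countable ((D \<inter> {t. g t$2 = 0}) \<union> {0,1})" by simp
  then have "negligible (\<Union>s\<in>(D \<inter> {t. g t$2 = 0}) \<union> {0,1}. {s})"
    by (intro negligible_countable_Union) auto
  then show ?thesis
    by (rule negligible_subset) (auto simp: D_def)
qed

lemma curve_integral_dx:
  "curve_integral f g = integral {0..1} (\<lambda>t. f (g t) * g' t$1)"
  unfolding curve_integral_def
proof (rule integral_cong)
  fix t :: real assume t: "t \<in> {0..1}"
  have "vector_derivative (\<lambda>s. g s $ 1) (at t within {0..1}) = g' t$1"
    by (rule vector_derivative_within_closed_interval[OF _ t deriv_component[OF t]]) simp
  then show "f (g t) * vector_derivative (\<lambda>s. g s $ 1) (at t within {0..1}) = f (g t) * g' t$1"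
    by simp
qed

lemma curve_integral_dx_over_2y:
  "curve_integral (\<lambda>P. h P / (2 * P$2)) g = integral {0..1} (\<lambda>t. h (g t) * nu t)"
  unfolding curve_integral_dx
proof (rule integral_spike[OF negligible_transversal_branch])
  fix t :: real assume "t \<in> {0..1} - {t \<in> {0..1}. g t$2 = 0 \<and> g' t$2 \<noteq> 0}"
  then have t: "t \<in> {0..1}" and "g t$2 \<noteq> 0 \<or> g' t$2 = 0" by auto
  \<comment> \<open>If both y and its velocity vanish, the left side is 0 because
    \<open>nu t = 0\<close> by \<open>branch_regular\<close>, and the right side is 0 because the
    velocity of x vanishes.\<close>
  then show "h (g t) * nu t = h (g t) / (2 * g t$2) * g' t$1"
    using nu_1[OF t] nu_2[OF t] branch_regular[OF t] by (cases "g t$2 = 0") auto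
qed

lemma integrable: "continuous_on {0..1} f \<Longrightarrow> f integrable_on {0..1}" for f :: "real \<Rightarrow> complex"
  by (rule integrable_continuous_real)

lemma nu_has_integral: "(nu has_integral omega) {0..1}"
  unfolding omega_def by (intro integrable_integral integrable cont_nu)

lemma x_nu_has_integral: "((\<lambda>t. g t$1 * nu t) has_integral eta) {0..1}"
  unfolding eta_def by (intro integrable_integral integrable continuous_intros cont cont_nu)

text \<open>(3x^2+a) dx/(2y) is the exact form dy, so x^2 dx/(2y) has the same periods as -(a/3)
  dx/(2y). This is the origin of the cubic term of the fibre co-ordinates.\<close>

lemma x2_nu_has_integral: "((\<lambda>t. (g t$1)^2 * nu t) has_integral - m$1 / 3 * omega) {0..1}"
proof -
  have "((\<lambda>t. g' t$2) has_integral g 1$2 - g 0$2) {0..1}"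
    by (rule fundamental_theorem_of_calculus) (use deriv_component in auto)
  then have "((\<lambda>t. (3 * (g t$1)^2 + m$1) * nu t) has_integral 0) {0..1}"
    by (rule has_integral_eq[rotated, THEN has_integral_eq_rhs]) (auto simp: nu_2 closed)
  from has_integral_mult_right[OF has_integral_diff[OF this has_integral_mult_right[OF nu_has_integral]], of "1/3" "m$1"]
  show ?thesis by (simp add: algebra_simps)
qed

text \<open>Euler's relation \<open>Z = E(Z)\<close>: the form \<open>5y dx - (4ax+6b) dx/(2y)\<close> is \<open>2 d(xy)\<close>.\<close>

lemma curve_integral_ydx:
  "curve_integral (\<lambda>P. P$2) g = 4 * m$1 / 5 * eta + 6 * m$2 / 5 * omega"
proof -
  have "((\<lambda>t. g t$1 * g' t$2 + g' t$1 * g t$2) has_integral g 1$1 * g 1$2 - g 0$1 * g 0$2) {0..1}"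
    by (rule fundamental_theorem_of_calculus)
       (use deriv_component in \<open>auto intro!: derivative_eq_intros\<close>)
  then have xy: "((\<lambda>t. g t$1 * g' t$2 + g' t$1 * g t$2) has_integral 0) {0..1}"
    by (simp add: closed)
  have "((\<lambda>t. g t$2 * g' t$1) has_integral
      (4 * m$1 / 5 * eta + 6 * m$2 / 5 * omega + 2 / 5 * 0)) {0..1}"
  proof (rule has_integral_eq)
    show "((\<lambda>t. 4 * m$1 / 5 * (g t$1 * nu t) + 6 * m$2 / 5 * nu t
        + 2 / 5 * (g t$1 * g' t$2 + g' t$1 * g t$2)) has_integral
        (4 * m$1 / 5 * eta + 6 * m$2 / 5 * omega + 2 / 5 * 0)) {0..1}"
      by (rule has_integral_add[OF has_integral_add[OF has_integral_mult_right[OF x_nu_has_integral]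
            has_integral_mult_right[OF nu_has_integral]] has_integral_mult_right[OF xy]])
    fix t :: real assume t: "t \<in> {0..1}"
    have "4 * a / 5 * (x * n) + 6 * b / 5 * n + 2 / 5 * (x * ((3 * x^2 + a) * n) + 2 * y * n * y) = y * (2 * y * n)"
      if "y^2 = x^3 + a * x + b" for x y a b n :: complex
    proof -
      have "4 * a / 5 * (x * n) + 6 * b / 5 * n + 2 / 5 * (x * ((3 * x^2 + a) * n) + 2 * y * n * y) - y * (2 * y * n)
          = 6 / 5 * n * (x^3 + a * x + b - y^2)"
        by (simp add: field_simps power2_eq_square power3_eq_cube)
      then show ?thesis unfolding that by simp
    qed
    then show "4 * m$1 / 5 * (g t$1 * nu t) + 6 * m$2 / 5 * nu t
        + 2 / 5 * (g t$1 * g' t$2 + g' t$1 * g t$2) = g t$2 * g' t$1"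
      unfolding nu_1[OF t] nu_2[OF t] using Weierstrass[OF t] by blast
  qed
  then show ?thesis
    by (simp add: curve_integral_dx integral_unique)
qed

lemma bounded_x:
  obtains B where "B > 0" "\<And>t. t \<in> {0..1} \<Longrightarrow> norm (g t$1) \<le> B"
proof -
  have "compact ((\<lambda>t. g t$1) ` {0..1})"
    by (intro compact_continuous_image continuous_intros cont) simp
  from compact_imp_bounded[OF this] show ?thesis
    using that unfolding bounded_pos by blast
qed

lemma bounded_nu:
  obtains B where "B > 0" "\<And>t. t \<in> {0..1} \<Longrightarrow> norm (nu t) \<le> B"
proof -
  have "compact (nu ` {0..1})"
    by (intro compact_continuous_image cont_nu) simp
  from compact_imp_bounded[OF this] show ?thesis
    using that unfolding bounded_pos by blast
qed

text \<open>Three terms of the geometric series of 1/(q-x), with exact remainder x^3/(q^3(q-x)),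
  integrated against \<open>nu\<close>. The part with \<open>r\<close> is integrated exactly, so the
  error bound depends on \<open>p\<close> and \<open>q\<close> alone.\<close>

lemma third_kind_expansion:
  "\<exists>M\<ge>0. \<exists>Q>0. \<forall>q. norm q \<ge> Q \<longrightarrow> (\<forall>t\<in>{0..1}. g t$1 \<noteq> q) \<and>
     (\<forall>p r. norm (- curve_integral (\<lambda>P. (p / (P$1 - q) + r) / (2 * P$2)) g
        - ((p / q - r) * omega + p / q^2 * eta - p / q^3 * (m$1 / 3) * omega)) \<le> M * norm p / norm q ^ 4)"
proof -
  obtain B where B: "B > 0" "\<And>t. t \<in> {0..1} \<Longrightarrow> norm (g t$1) \<le> B" using bounded_x by blast
  obtain N where N: "N > 0" "\<And>t. t \<in> {0..1} \<Longrightarrow> norm (nu t) \<le> N" using bounded_nu by blast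
  \<comment> \<open>For \<open>norm q \<ge> 2 * B\<close> the x-co-ordinate of the loop stays at
    distance at least \<open>norm q / 2\<close> from \<open>q\<close>; this accounts for the factor
    2.\<close>
  define M where "M = 2 * B^3 * N"
  have "(\<forall>t\<in>{0..1}. g t$1 \<noteq> q) \<and>
     (\<forall>p r. norm (- curve_integral (\<lambda>P. (p / (P$1 - q) + r) / (2 * P$2)) g
        - ((p / q - r) * omega + p / q^2 * eta - p / q^3 * (m$1 / 3) * omega)) \<le> M * norm p / norm q ^ 4)"
    if q: "norm q \<ge> 2 * B" for q
  proof (intro conjI ballI allI)
    have far: "norm (g t$1 - q) \<ge> norm q / 2" if "t \<in> {0..1}" for t
      using norm_triangle_ineq2[of q "g t$1"] B(2)[OF that] q by (simp add: norm_minus_commute)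
    have q0: "norm q > 0" "q \<noteq> 0" using q B(1) by auto
    show ne: "g t$1 \<noteq> q" if "t \<in> {0..1}" for t
      using far[OF that] q0 by auto
    fix p r
    define R where "R = (\<lambda>t. - (p / q^3 * ((g t$1)^3 / (g t$1 - q)) * nu t))"
    have cR: "continuous_on {0..1} R"
      unfolding R_def by (intro continuous_intros cont cont_nu) (use ne in auto)
    have "- curve_integral (\<lambda>P. (p / (P$1 - q) + r) / (2 * P$2)) g
      = integral {0..1} (\<lambda>t. - ((p / (g t$1 - q) + r) * nu t))"
      by (simp add: curve_integral_dx_over_2y[of "\<lambda>P. p / (P$1 - q) + r"])
    also have "\<dots> = integral {0..1} (\<lambda>t. (p / q - r) * nu t + (p / q^2 * (g t$1 * nu t) + (p / q^3 * ((g t$1)^2 * nu t) + R t)))"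
    proof (rule integral_cong)
      fix t :: real assume "t \<in> {0..1}"
      then have "g t$1 - q \<noteq> 0" using ne by simp
      then have eq: "- (p / (g t$1 - q)) = p / q + p / q^2 * g t$1 + p / q^3 * (g t$1)^2 - p / q^3 * ((g t$1)^3 / (g t$1 - q))"
        using q0(2) by (simp add: divide_simps power2_eq_square power3_eq_cube) (simp add: algebra_simps)
      show "- ((p / (g t$1 - q) + r) * nu t) = (p / q - r) * nu t + (p / q^2 * (g t$1 * nu t) + (p / q^3 * ((g t$1)^2 * nu t) + R t))"
      proof -
        have "- ((p / (g t$1 - q) + r) * nu t) = (- (p / (g t$1 - q)) - r) * nu t"
          by (simp add: algebra_simps)
        then show ?thesis unfolding eq R_def by (simp add: algebra_simps)
      qed
    qed
    also have "\<dots> = (p / q - r) * omega + (p / q^2 * eta + (p / q^3 * (- m$1 / 3 * omega) + integral {0..1} R))"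
      by (rule integral_unique, rule has_integral_add[OF has_integral_mult_right[OF nu_has_integral]
            has_integral_add[OF has_integral_mult_right[OF x_nu_has_integral]
            has_integral_add[OF has_integral_mult_right[OF x2_nu_has_integral] integrable_integral[OF integrable[OF cR]]]]])
    finally have "- curve_integral (\<lambda>P. (p / (P$1 - q) + r) / (2 * P$2)) g
        - ((p / q - r) * omega + p / q^2 * eta - p / q^3 * (m$1 / 3) * omega) = integral {0..1} R"
      by simp
    moreover have "norm (integral {0..1} R) \<le> (M * norm p / norm q ^ 4) * (1 - 0)"
    proof (rule integral_bound[OF _ cR])
      fix t :: real assume t: "t \<in> {0..1}"
      have "norm (R t) = norm p / norm q ^ 3 * (norm (g t$1) ^ 3 / norm (g t$1 - q)) * norm (nu t)"
        by (simp add: R_def norm_mult norm_divide norm_power)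
      also have "\<dots> \<le> norm p / norm q ^ 3 * (B ^ 3 / (norm q / 2)) * N"
        using q0 B(1) N(1) by (intro mult_mono frac_le power_mono B(2) N(2) far t) auto
      also have "\<dots> = M * norm p / norm q ^ 4"
        using q0(1) by (simp add: M_def field_simps power3_eq_cube power4_eq_xxxx)
      finally show "norm (R t) \<le> M * norm p / norm q ^ 4" .
    qed simp
    ultimately show "norm (- curve_integral (\<lambda>P. (p / (P$1 - q) + r) / (2 * P$2)) g
        - ((p / q - r) * omega + p / q^2 * eta - p / q^3 * (m$1 / 3) * omega)) \<le> M * norm p / norm q ^ 4"
      by simp
  qed
  moreover have "M \<ge> 0" "2 * B > 0" using B N by (auto simp: M_def)
  ultimately show ?thesis by blast
qed

end

section \<open>Derivatives of periods\<close>

text \<open>Cauchy's inequality on discs of radius \<open>r / 2\<close> bounds the derivative on the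
  half disc. The constant depends only on the bound for \<open>f\<close>, hence is uniform over the
  points of a loop.\<close>

lemma holomorphic_bounded_Lipschitz_0:
  fixes f :: "complex \<Rightarrow> complex"
  assumes hol: "f holomorphic_on ball 0 r" and cont: "continuous_on (cball 0 r) f" and r: "r > 0"
    and bd: "\<And>z. norm z \<le> r \<Longrightarrow> norm (f z) \<le> B" and h: "norm h < r / 2"
  shows "norm (f h - f 0) \<le> 2 * B / r * norm h"
proof -
  have "norm (f h - f 0) \<le> 2 * B / r * norm (h - 0)"
  proof (rule field_differentiable_bound[of "ball 0 (r/2)" f "deriv f"])
  fix z :: complex assume z: "z \<in> ball 0 (r/2)"
  have sub: "ball z (r/2) \<subseteq> ball 0 r" "cball z (r/2) \<subseteq> cball 0 r"
    using z by (auto simp: dist_norm intro: order_trans[OF norm_triangle_sub[of _ z]])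
      (smt (verit) field_sum_of_halves norm_minus_commute norm_triangle_sub)+
  have "norm ((deriv ^^ 1) f z) \<le> fact 1 * B / (r/2) ^ 1"
    by (rule Cauchy_inequality[OF holomorphic_on_subset[OF hol sub(1)] continuous_on_subset[OF cont sub(2)]])
       (use r sub(2) in \<open>auto intro!: bd simp: subset_iff dist_norm\<close>)
  then show "norm (deriv f z) \<le> 2 * B / r" by (simp add: mult.commute)
  show "(f has_field_derivative deriv f z) (at z within ball 0 (r/2))"
    by (rule has_field_derivative_at_within, rule holomorphic_derivI[OF hol]) (use z r in auto)
  qed (use h r in auto)
  then show ?thesis by simp
qed

lemma smooth_curve_loop_family:
  assumes "loop_family U c" "U \<subseteq> base" "m \<in> U"
    and c': "continuous_on (U \<times> {0..1}) (\<lambda>(m,t). c' m t)"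
    "\<And>m t. m \<in> U \<Longrightarrow> t \<in> {0..1} \<Longrightarrow> (c m has_vector_derivative c' m t) (at t within {0..1})"
  shows "smooth_curve_loop m (c m) (c' m)"
proof
  have loop: "curve_loop m (c m)"
    using assms unfolding loop_family_def by blast
  show "m \<in> base" using assms by blast
  show "c m t \<in> affine_curve m" if "t \<in> {0..1}" for t
    using loop that by (auto simp: curve_loop_def path_image_def)
  show "c m 1 = c m 0"
    using loop by (simp add: curve_loop_def pathfinish_def pathstart_def)
  show "(c m has_vector_derivative c' m t) (at t within {0..1})" if "t \<in> {0..1}" for t
    using c'(2) assms(3) that by blast
  have "continuous_on {0..1} (\<lambda>t. (\<lambda>(m,t). c' m t) (m, t))"
    by (rule continuous_on_compose2[OF c'(1)]) (use assms(3) in \<open>auto intro!: continuous_intros\<close>)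
  then show "continuous_on {0..1} (c' m)" by simp
qed

text \<open>Integration by parts turns the difference of \<open>\<integral> y dx\<close> over two neighbouring loops into half the
  integral of \<open>(Y - y)(X' + x') - (X - x)(Y' + y')\<close>, so that only the points of the loops, not their
  velocities, have to be differentiated in the parameter.\<close>

lemma DERIV_curve_integral_ydx:
  assumes fam: "loop_family U c" and U: "open U" "U \<subseteq> base" "m \<in> U"
    and c': "continuous_on (U \<times> {0..1}) (\<lambda>(m,t). c' m t)"
    "\<And>m t. m \<in> U \<Longrightarrow> t \<in> {0..1} \<Longrightarrow> (c m has_vector_derivative c' m t) (at t within {0..1})"
  shows "((\<lambda>s. curve_integral (\<lambda>P. P$2) (c (m + axis k s))) has_field_derivative
      integral {0..1} (\<lambda>t. (if k = 1 then c m t$1 else 1) * smooth_curve_loop.nu m (c m) (c' m) t)) (at 0)"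
proof -
  interpret L: smooth_curve_loop m "c m" "c' m"
    by (rule smooth_curve_loop_family[OF fam U(2,3) c'])
  obtain r where r: "r > 0" "cball m r \<subseteq> U"
    using U open_contains_cball by blast
  have mU: "m + axis k s \<in> U" if "norm s \<le> r" for s
    using r(2) that by (auto simp: dist_norm norm_axis)
  have bl: "bounded_linear (axis k :: complex \<Rightarrow> complex^2)"
    using linear_axis by (simp add: linear_conv_bounded_linear)
  define F where "F = (\<lambda>s t. c (m + axis k s) t)"
  define F' where "F' = (\<lambda>s t. c' (m + axis k s) t)"
  have F0: "F 0 = c m" "F' 0 = c' m"
    by (simp_all add: F_def F'_def linear_0[OF linear_axis])
  let ?K = "cball (0::complex) r \<times> {0..1::real}"
  have cF: "continuous_on ?K (\<lambda>p. F (fst p) (snd p))"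
  proof -
    have "continuous_on ?K (\<lambda>p. (\<lambda>(m,t). c m t) (m + axis k (fst p), snd p))"
      by (rule continuous_on_compose2[of "U \<times> {0..1}"])
         (use fam mU in \<open>auto simp: loop_family_def intro!: continuous_intros bounded_linear.continuous_on[OF bl]\<close>)
    then show ?thesis by (simp add: F_def)
  qed
  have cF': "continuous_on ?K (\<lambda>p. F' (fst p) (snd p))"
  proof -
    have "continuous_on ?K (\<lambda>p. (\<lambda>(m,t). c' m t) (m + axis k (fst p), snd p))"
      by (rule continuous_on_compose2[OF c'(1)])
         (use mU in \<open>auto intro!: continuous_intros bounded_linear.continuous_on[OF bl]\<close>)
    then show ?thesis by (simp add: F'_def)
  qed
  have K: "compact ?K" by (intro compact_Times) auto
  obtain B1 where B1: "\<And>s t. norm s \<le> r \<Longrightarrow> t \<in> {0..1} \<Longrightarrow> norm (F s t) \<le> B1"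
  proof -
    have "bounded ((\<lambda>p. F (fst p) (snd p)) ` ?K)"
      by (intro compact_imp_bounded compact_continuous_image cF K)
    then show ?thesis using that unfolding bounded_iff by fastforce
  qed
  obtain B2 where B2: "\<And>s t. norm s \<le> r \<Longrightarrow> t \<in> {0..1} \<Longrightarrow> norm (F' s t) \<le> B2"
  proof -
    have "bounded ((\<lambda>p. F' (fst p) (snd p)) ` ?K)"
      by (intro compact_imp_bounded compact_continuous_image cF' K)
    then show ?thesis using that unfolding bounded_iff by fastforce
  qed
  define v where "v = (\<lambda>t j. pderiv_at k (\<lambda>m. c m t $ j) m)"
  have hol: "holomorphic_map (*s) (*) (\<lambda>m. c m t $ j) U" if t: "t \<in> {0..1}" for t j
    unfolding holomorphic_map_def
  proof
    fix z assume "z \<in> U"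
    then obtain f' where "((\<lambda>m. c m t) has_derivative f') (at z)" "\<forall>a v. f' (a *s v) = a *s f' v"
      using fam t unfolding loop_family_def holomorphic_map_def by blast
    then show "\<exists>f'. ((\<lambda>m. c m t $ j) has_derivative f') (at z) \<and> (\<forall>c v. f' (c *s v) = c * f' v)"
      by (intro exI[of _ "\<lambda>v. f' v $ j"])
         (auto intro: bounded_linear.has_derivative[OF bounded_linear_vec_nth])
  qed
  have dF: "((\<lambda>s. F s t $ j) has_field_derivative pderiv_at k (\<lambda>m. c m t $ j) (m + axis k s)) (at s)"
    if "t \<in> {0..1}" "norm s \<le> r" for t s j
    unfolding F_def by (rule DERIV_axis[OF hol[OF that(1)] mU[OF that(2)]])
  have v: "((\<lambda>s. F s t $ j) has_field_derivative v t j) (at 0)" if "t \<in> {0..1}" for t j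
    using dF[OF that, of 0] r(1) by (simp add: v_def linear_0[OF linear_axis])
  define L where "L = 2 * B1 / r"
  have Lip: "norm (F h t $ j - F 0 t $ j) \<le> L * norm h" if "t \<in> {0..1}" "norm h < r / 2" for t h j
    unfolding L_def
  proof (rule holomorphic_bounded_Lipschitz_0[OF _ _ r(1) _ that(2)])
    show "(\<lambda>s. F s t $ j) holomorphic_on ball 0 r"
      by (intro holomorphic_onI) (use dF[OF that(1)] in
        \<open>auto simp: field_differentiable_def intro!: exI intro: has_field_derivative_at_within less_imp_le\<close>)
    show "continuous_on (cball 0 r) (\<lambda>s. F s t $ j)"
      by (intro continuous_at_imp_continuous_on ballI) (use dF[OF that(1), THEN DERIV_isCont] in auto)
    show "norm (F z t $ j) \<le> B1" if "norm z \<le> r" for z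
      using B1[OF that \<open>t \<in> {0..1}\<close>] Finite_Cartesian_Product.norm_nth_le order_trans by blast
  qed
  \<comment> \<open>\<open>kap t\<close> is the derivative of x^3+ax+b in the k-th parameter with x
    fixed: x for the parameter a, and 1 for b.\<close>
  define kap where "kap = (\<lambda>t. if k = 1 then c m t $ 1 else 1)"
  have loop: "smooth_curve_loop (m + axis k s) (F s) (F' s)" if "norm s \<le> r" for s
    unfolding F_def F'_def by (rule smooth_curve_loop_family[OF fam U(2) mU[OF that] c'])
  \<comment> \<open>The curve equation is differentiated in the parameter at a fixed time
    \<open>t\<close>; \<open>v t\<close> is the resulting displacement of the point.\<close>
  have tangent: "2 * c m t $ 2 * v t 2 = (3 * (c m t $ 1)^2 + m$1) * v t 1 + kap t" if t: "t \<in> {0..1}" for t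
  proof -
    have ax: "((\<lambda>s. (m + axis k s) $ j) has_field_derivative (if j = k then 1 else 0)) (at 0)" for j
      by (cases "j = k") (auto simp: axis_def intro!: derivative_eq_intros)
    have 1: "((\<lambda>s. (F s t $ 2)^2) has_field_derivative 2 * c m t $ 2 * v t 2) (at 0)"
      using v[OF t] by (auto intro!: derivative_eq_intros simp: F0)
    have "((\<lambda>s. (F s t $ 1)^3 + (m + axis k s)$1 * F s t $ 1 + (m + axis k s)$2) has_field_derivative
        3 * (c m t $ 1)^2 * v t 1 + ((if 1 = k then 1 else 0) * F 0 t $ 1 + v t 1 * (m + axis k 0)$1)
          + (if 2 = k then 1 else 0)) (at 0)"
      by (intro DERIV_add DERIV_mult ax v t) (use v[OF t] in \<open>auto intro!: derivative_eq_intros simp: F0\<close>)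
    moreover have "3 * (c m t $ 1)^2 * v t 1 + ((if 1 = k then 1 else 0) * F 0 t $ 1 + v t 1 * (m + axis k 0)$1)
          + (if 2 = k then 1 else 0) = (3 * (c m t $ 1)^2 + m$1) * v t 1 + kap t"
      using exhaust_2[of k] by (auto simp: kap_def F0 linear_0[OF linear_axis] algebra_simps)
    ultimately have "((\<lambda>s. (F s t $ 1)^3 + (m + axis k s)$1 * F s t $ 1 + (m + axis k s)$2) has_field_derivative
        (3 * (c m t $ 1)^2 + m$1) * v t 1 + kap t) (at 0)"
      by simp
    then have "((\<lambda>s. (F s t $ 2)^2) has_field_derivative (3 * (c m t $ 1)^2 + m$1) * v t 1 + kap t) (at 0)"
    proof (rule has_field_derivative_transform_within_open[OF _ open_ball])
      show "0 \<in> ball (0::complex) r" using r by simp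
      fix s assume "s \<in> ball (0::complex) r"
      then have "norm s \<le> r" by simp
      from smooth_curve_loop.Weierstrass[OF loop[OF this] t]
      show "(F s t $ 1)^3 + (m + axis k s)$1 * F s t $ 1 + (m + axis k s)$2 = (F s t $ 2)^2" by simp
    qed
    from DERIV_unique[OF 1 this] show ?thesis .
  qed
  define D where "D = (\<lambda>h t. (F h t$2 - F 0 t$2) * (F' h t$1 + F' 0 t$1)
       - (F h t$1 - F 0 t$1) * (F' h t$2 + F' 0 t$2))"
  have cD: "continuous_on {0..1} (D h)" if "norm h < r / 2" for h
  proof -
    have "norm h \<le> r" "norm (0::complex) \<le> r" using that r(1) by auto
    from this[THEN loop] show ?thesis
      unfolding D_def
      by (intro continuous_intros smooth_curve_loop.cont smooth_curve_loop.cont')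
  qed
  have main: "(\<lambda>n. integral {0..1} (\<lambda>t. D (h n) t / (2 * h n)))
     \<longlonglongrightarrow> integral {0..1} (\<lambda>t. kap t * L.nu t)"
    if h: "\<And>n. h n \<noteq> 0" "\<And>n. norm (h n) < r / 2" "h \<longlonglongrightarrow> 0" for h
  proof (rule dominated_convergence(2)[where h = "\<lambda>_. 2 * L * B2"])
    show "(\<lambda>_::real. 2 * L * B2) integrable_on {0..1}" by (rule integrable_const_ivl)
    show "(\<lambda>t. D (h n) t / (2 * h n)) integrable_on {0..1}" for n
      by (intro integrable_continuous_real continuous_intros cD h) (use h in auto)
    fix t :: real assume t: "t \<in> {0..1}"
    \<comment> \<open>Each of the two products in \<open>D\<close> is at most L|h| times 2 B2, and
      their sum is divided by 2|h|.\<close>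
    show "norm (D (h n) t / (2 * h n)) \<le> 2 * L * B2" for n
    proof -
      have nh: "norm (h n) \<le> r" using h(2)[of n] r(1) norm_ge_zero[of "h n"] by linarith
      have B: "norm (F' (h n) t $ j + F' 0 t $ j) \<le> 2 * B2" for j
      proof -
        have "norm (F' s t $ j) \<le> B2" if "norm s \<le> r" for s
          using B2[OF that t] Finite_Cartesian_Product.norm_nth_le order_trans by blast
        from this[OF nh] this[of 0] r(1) norm_triangle_ineq[of "F' (h n) t $ j" "F' 0 t $ j"]
        show ?thesis by simp
      qed
      have "norm (D (h n) t) \<le> L * norm (h n) * (2 * B2) + L * norm (h n) * (2 * B2)"
        unfolding D_def
        by (intro order_trans[OF norm_triangle_ineq4] add_mono; unfold norm_mult)
           (intro mult_mono Lip B t h order_trans[OF norm_ge_zero Lip[OF t h(2)]] norm_ge_zero)+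
      then show ?thesis
        using h(1)[of n] by (simp add: norm_divide norm_mult field_simps)
    qed
    have q: "(\<lambda>n. (F (h n) t $ j - F 0 t $ j) / h n) \<longlonglongrightarrow> v t j" for j
    proof -
      have "filterlim h (at 0) sequentially"
        using h by (auto simp: filterlim_at)
      with v[OF t, of j] show ?thesis
        unfolding has_field_derivative_iff by (auto dest: filterlim_compose)
    qed
    have q': "(\<lambda>n. F' (h n) t $ j) \<longlonglongrightarrow> F' 0 t $ j" for j
    proof -
      have "(\<lambda>n. (h n, t)) \<longlonglongrightarrow> (0, t)"
        using h(3) by (intro tendsto_Pair tendsto_const)
      moreover have "norm (h n) \<le> r" for n
        using h(2)[of n] r(1) norm_ge_zero[of "h n"] by linarith
      ultimately have "(\<lambda>n. (\<lambda>p. F' (fst p) (snd p)) (h n, t)) \<longlonglongrightarrow> (\<lambda>p. F' (fst p) (snd p)) (0, t)"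
        using t r(1) by (intro continuous_on_tendsto_compose[OF cF']) auto
      then show ?thesis by (auto intro: tendsto_vec_nth)
    qed
    have "(\<lambda>n. ((F (h n) t$2 - F 0 t$2) / h n * (F' (h n) t$1 + F' 0 t$1)
       - (F (h n) t$1 - F 0 t$1) / h n * (F' (h n) t$2 + F' 0 t$2)) / 2) \<longlonglongrightarrow>
       (v t 2 * (F' 0 t$1 + F' 0 t$1) - v t 1 * (F' 0 t$2 + F' 0 t$2)) / 2"
      by (intro tendsto_intros q q') simp
    moreover have "(v t 2 * (F' 0 t$1 + F' 0 t$1) - v t 1 * (F' 0 t$2 + F' 0 t$2)) / 2 = kap t * L.nu t"
    proof -
      have "(v t 2 * (F' 0 t$1 + F' 0 t$1) - v t 1 * (F' 0 t$2 + F' 0 t$2)) / 2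
          = (2 * c m t $ 2 * v t 2 - (3 * (c m t $ 1)^2 + m$1) * v t 1) * L.nu t"
        unfolding F0 L.nu_1[OF t] L.nu_2[OF t] by (simp add: field_simps)
      then show ?thesis unfolding tangent[OF t] by simp
    qed
    moreover have "((F (h n) t$2 - F 0 t$2) / h n * (F' (h n) t$1 + F' 0 t$1)
       - (F (h n) t$1 - F 0 t$1) / h n * (F' (h n) t$2 + F' 0 t$2)) / 2 = D (h n) t / (2 * h n)" for n
      using h(1)[of n] by (simp add: D_def field_simps)
    ultimately show "(\<lambda>n. D (h n) t / (2 * h n)) \<longlonglongrightarrow> kap t * L.nu t"
      by (simp only:)
  qed
  have diff: "curve_integral (\<lambda>P. P$2) (c (m + axis k h)) - curve_integral (\<lambda>P. P$2) (c m)
      = h * integral {0..1} (\<lambda>t. D h t / (2 * h))" if h: "h \<noteq> 0" "norm h < r / 2" for h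
  proof -
    have "norm h \<le> r" using h(2) r(1) norm_ge_zero[of h] by linarith
    then interpret X: smooth_curve_loop "m + axis k h" "F h" "F' h" by (rule loop)
    \<comment> \<open>This is the derivative of (X-x)(Y+y), with X, Y the co-ordinates of
      \<open>F h\<close> and x, y those of \<open>c m\<close>. Its integral vanishes since both
      loops are closed.\<close>
    have "((\<lambda>t. (F h t$1 * F' h t$2 + F' h t$1 * F h t$2) - (c m t$1 * c' m t$2 + c' m t$1 * c m t$2)
         - (c m t$1 * F' h t$2 + c' m t$1 * F h t$2) + (F h t$1 * c' m t$2 + F' h t$1 * c m t$2))
        has_integral (F h 1$1 * F h 1$2 - c m 1$1 * c m 1$2 - c m 1$1 * F h 1$2 + F h 1$1 * c m 1$2)
          - (F h 0$1 * F h 0$2 - c m 0$1 * c m 0$2 - c m 0$1 * F h 0$2 + F h 0$1 * c m 0$2)) {0..1}"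
      by (rule fundamental_theorem_of_calculus)
         (use X.deriv_component L.deriv_component in
           \<open>auto intro!: has_vector_derivative_add has_vector_derivative_diff has_vector_derivative_mult\<close>)
    then have e: "((\<lambda>t. (F h t$1 * F' h t$2 + F' h t$1 * F h t$2) - (c m t$1 * c' m t$2 + c' m t$1 * c m t$2)
         - (c m t$1 * F' h t$2 + c' m t$1 * F h t$2) + (F h t$1 * c' m t$2 + F' h t$1 * c m t$2))
        has_integral 0) {0..1}"
      by (simp add: X.closed L.closed)
    have i1: "((\<lambda>t. F h t$2 * F' h t$1) has_integral curve_integral (\<lambda>P. P$2) (F h)) {0..1}"
      unfolding X.curve_integral_dx
      by (intro integrable_integral integrable_continuous_real continuous_intros X.cont X.cont')
    have i2: "((\<lambda>t. c m t$2 * c' m t$1) has_integral curve_integral (\<lambda>P. P$2) (c m)) {0..1}"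
      unfolding L.curve_integral_dx
      by (intro integrable_integral integrable_continuous_real continuous_intros L.cont L.cont')
    have "((\<lambda>t. D h t / (2 * h)) has_integral
       1 / (2 * h) * (2 * (curve_integral (\<lambda>P. P$2) (F h) - curve_integral (\<lambda>P. P$2) (c m)) - 0)) {0..1}"
    proof (rule has_integral_eq[rotated])
      show "((\<lambda>t. 1 / (2 * h) * (2 * (F h t$2 * F' h t$1 - c m t$2 * c' m t$1)
          - ((F h t$1 * F' h t$2 + F' h t$1 * F h t$2) - (c m t$1 * c' m t$2 + c' m t$1 * c m t$2)
         - (c m t$1 * F' h t$2 + c' m t$1 * F h t$2) + (F h t$1 * c' m t$2 + F' h t$1 * c m t$2))))
        has_integral 1 / (2 * h) * (2 * (curve_integral (\<lambda>P. P$2) (F h) - curve_integral (\<lambda>P. P$2) (c m)) - 0)) {0..1}"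
        by (rule has_integral_mult_right[OF has_integral_diff[OF has_integral_mult_right[OF has_integral_diff[OF i1 i2]] e]])
      show "1 / (2 * h) * (2 * (F h t$2 * F' h t$1 - c m t$2 * c' m t$1)
          - ((F h t$1 * F' h t$2 + F' h t$1 * F h t$2) - (c m t$1 * c' m t$2 + c' m t$1 * c m t$2)
         - (c m t$1 * F' h t$2 + c' m t$1 * F h t$2) + (F h t$1 * c' m t$2 + F' h t$1 * c m t$2)))
        = D h t / (2 * h)" for t
        unfolding D_def F0 using h(1) by (simp add: field_simps)
    qed
    from integral_unique[OF this] show ?thesis
      using h(1) by (simp add: F_def)
  qed
  \<comment> \<open>The limit is tested on sequences, the form of dominated convergence used in
    \<open>main\<close>. Staying within the disc of radius \<open>r/2\<close> makes every term of
    the sequence admissible there.\<close>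
  have "((\<lambda>h. (curve_integral (\<lambda>P. P$2) (c (m + axis k h)) - curve_integral (\<lambda>P. P$2) (c m)) / h)
      \<longlongrightarrow> integral {0..1} (\<lambda>t. kap t * L.nu t)) (at 0 within ball 0 (r/2))"
    unfolding tendsto_at_iff_sequentially comp_def
  proof (intro allI impI)
    fix h :: "nat \<Rightarrow> complex" assume h: "\<forall>n. h n \<in> ball 0 (r/2) - {0}" "h \<longlonglongrightarrow> 0"
    show "(\<lambda>n. (curve_integral (\<lambda>P. P$2) (c (m + axis k (h n))) - curve_integral (\<lambda>P. P$2) (c m)) / h n)
       \<longlonglongrightarrow> integral {0..1} (\<lambda>t. kap t * L.nu t)"
    proof -
      have "(curve_integral (\<lambda>P. P$2) (c (m + axis k (h n))) - curve_integral (\<lambda>P. P$2) (c m)) / h n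
        = integral {0..1} (\<lambda>t. D (h n) t / (2 * h n))" for n
        by (subst diff) (use h in auto)
      then show ?thesis using main[of h] h by simp
    qed
  qed
  then have "((\<lambda>h. (curve_integral (\<lambda>P. P$2) (c (m + axis k h)) - curve_integral (\<lambda>P. P$2) (c m)) / h)
      \<longlongrightarrow> integral {0..1} (\<lambda>t. kap t * L.nu t)) (at 0)"
    using r(1) at_within_open[of 0 "ball (0::complex) (r/2)"] by simp
  then show ?thesis
    unfolding has_field_derivative_iff kap_def by (simp add: linear_0[OF linear_axis])
qed

section \<open>Points of the torus\<close>

lemma nat_pow_Cstar: "z [^]\<^bsub>Cstar\<^esub> (n::nat) = z ^ n"
  by (induction n) (auto simp: Cstar_def nat_pow_def)

lemma group_Cstar: "group Cstar"
proof (rule groupI)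
  show "\<exists>y\<in>carrier Cstar. y \<otimes>\<^bsub>Cstar\<^esub> x = \<one>\<^bsub>Cstar\<^esub>" if "x \<in> carrier Cstar" for x
    using that by (auto simp: Cstar_def intro!: bexI[of _ "inverse x"])
qed (auto simp: Cstar_def)

lemma int_pow_Cstar: 
  assumes "z \<noteq> 0"
  shows "z [^]\<^bsub>Cstar\<^esub> (n::int) = z powi n"
proof -
  have "inv\<^bsub>Cstar\<^esub> w = inverse w" if "w \<noteq> 0" for w
    by (rule group.inv_equality[OF group_Cstar]) (use that in \<open>auto simp: Cstar_def\<close>)
  then show ?thesis
    using assms by (auto simp: int_pow_def2 nat_pow_Cstar power_int_def power_inverse)
qed

text \<open>A free abelian group of rank two has one character with given nonzero values on a basis,
  so the description in \<open>torus_point\<close> denotes. Extensionality fixes the values outside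
  the carrier.\<close>

lemma hom_Cstar_ex1:
  fixes e :: "2 \<Rightarrow> 'a" and \<theta> :: "complex^2"
  assumes G: "comm_group G" and e: "\<And>i. e i \<in> carrier G"
    and basis: "\<And>x. x \<in> carrier G \<Longrightarrow> \<exists>!n :: int^2. x = (e 1 [^]\<^bsub>G\<^esub> n$1) \<otimes>\<^bsub>G\<^esub> (e 2 [^]\<^bsub>G\<^esub> n$2)"
  shows "\<exists>!\<xi>. \<xi> \<in> hom G Cstar \<inter> extensional (carrier G) \<and> (\<forall>i. \<xi> (e i) = exp (\<theta>$i))"
proof -
  interpret G: comm_group G by fact
  define E where "E = (\<lambda>n :: int^2. (e 1 [^]\<^bsub>G\<^esub> n$1) \<otimes>\<^bsub>G\<^esub> (e 2 [^]\<^bsub>G\<^esub> n$2))"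
  have E: "E n \<in> carrier G" for n by (simp add: E_def e)
  have E_add: "E (n + k) = E n \<otimes>\<^bsub>G\<^esub> E k" for n k
    by (simp add: E_def e G.int_pow_mult G.m_ac)
  obtain N where N: "\<And>x. x \<in> carrier G \<Longrightarrow> x = E (N x)" 
    and N_unique: "\<And>x n. x \<in> carrier G \<Longrightarrow> x = E n \<Longrightarrow> n = N x"
    using basis unfolding E_def by metis
  have NE: "N (E n) = n" for n using N_unique[OF E] by metis
  have N_mult: "N (x \<otimes>\<^bsub>G\<^esub> y) = N x + N y" if "x \<in> carrier G" "y \<in> carrier G" for x y
    using N[OF that(1)] N[OF that(2)] E_add NE by metis
  have Ne: "N (e i) = axis i 1" for i
  proof -
    have "E (axis i 1) = e i"
      using exhaust_2[of i] e by (auto simp: E_def axis_def)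
    then show ?thesis using NE by metis
  qed
  define \<xi> where "\<xi> = restrict (\<lambda>x. exp (\<Sum>i\<in>UNIV. of_int (N x $ i) * \<theta>$i)) (carrier G)"
  show ?thesis
  proof (rule ex1I[of _ \<xi>])
    have "\<xi> \<in> hom G Cstar"
      by (rule homI) (auto simp: \<xi>_def Cstar_def N_mult sum_2 exp_add[symmetric] algebra_simps)
    moreover have "\<xi> (e i) = exp (\<theta>$i)" for i
      using exhaust_2[of i] by (auto simp: \<xi>_def e Ne sum_2 axis_def)
    ultimately show "\<xi> \<in> hom G Cstar \<inter> extensional (carrier G) \<and> (\<forall>i. \<xi> (e i) = exp (\<theta>$i))"
      by (simp add: \<xi>_def)
    fix \<zeta> assume \<zeta>: "\<zeta> \<in> hom G Cstar \<inter> extensional (carrier G) \<and> (\<forall>i. \<zeta> (e i) = exp (\<theta>$i))"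
    show "\<zeta> = \<xi>"
    proof (rule extensionalityI[of _ "carrier G"])
      fix x assume x: "x \<in> carrier G"
      have "\<zeta> x = \<zeta> (E (N x))" using N[OF x] by simp
      also have "\<dots> = exp (\<theta>$1) powi (N x $ 1) * exp (\<theta>$2) powi (N x $ 2)"
      proof -
        have hom: "\<zeta> \<in> hom G Cstar" and \<zeta>e: "\<And>i. \<zeta> (e i) = exp (\<theta>$i)" using \<zeta> by auto
        have pow: "\<zeta> (e i [^]\<^bsub>G\<^esub> k) = exp (\<theta>$i) powi k" for i and k :: int
          using hom_int_pow[OF hom e G.group_axioms group_Cstar] by (simp add: \<zeta>e int_pow_Cstar)
        have "\<zeta> (E (N x)) = \<zeta> (e 1 [^]\<^bsub>G\<^esub> N x $ 1) \<otimes>\<^bsub>Cstar\<^esub> \<zeta> (e 2 [^]\<^bsub>G\<^esub> N x $ 2)"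
          unfolding E_def by (intro hom_mult[OF hom] G.int_pow_closed e)
        then show ?thesis unfolding pow by (simp add: Cstar_def)
      qed
      also have "\<dots> = exp (of_int (N x $ 1) * \<theta>$1 + of_int (N x $ 2) * \<theta>$2)"
        unfolding exp_power_int exp_add ..
      also have "\<dots> = \<xi> x"
        using x by (simp add: \<xi>_def sum_2)
      finally show "\<zeta> x = \<xi> x" .
    qed (use \<zeta> in \<open>auto simp: \<xi>_def\<close>)
  qed
qed

lemma period_frameD:
  assumes "period_frame U c" "m \<in> U"
  shows "loop_family U (c i)" "open U" "U \<subseteq> base" "anti_invariant (c i m)"
    "loop_class m (c i m) \<in> carrier (Gam m)" "curve_loop m (c i m)"
    "\<And>\<gamma>. \<gamma> \<in> carrier (Gam m) \<Longrightarrow> \<exists>!n :: int^2.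
      \<gamma> = (loop_class m (c 1 m) [^]\<^bsub>Gam m\<^esub> n$1) \<otimes>\<^bsub>Gam m\<^esub> (loop_class m (c 2 m) [^]\<^bsub>Gam m\<^esub> n$2)"
  using assms unfolding period_frame_def loop_family_def by simp_all

lemma torus_point:
  assumes "period_frame U c" "m \<in> U"
  shows torus_point_in_torus: "torus_point c m \<theta> \<in> torus m"
    and torus_point_loop_class: "torus_point c m \<theta> (loop_class m (c i m)) = exp (\<theta>$i)"
proof -
  have "\<exists>!\<xi>. \<xi> \<in> torus m \<and> (\<forall>i. \<xi> (loop_class m (c i m)) = exp (\<theta>$i))"
    unfolding torus_def
    by (rule hom_Cstar_ex1[OF abelian_homology_group period_frameD(5)[OF assms] period_frameD(7)[OF assms]])
  from theI'[OF this] show "torus_point c m \<theta> \<in> torus m"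
    "torus_point c m \<theta> (loop_class m (c i m)) = exp (\<theta>$i)"
    unfolding torus_point_def by auto
qed

section \<open>Homology classes of integer combinations of loops\<close>

text \<open>The class of a cycle is its right coset modulo boundaries, so taking classes is the
  quotient homomorphism.\<close>

lemma homologous_rel_set_hom:
  "homologous_rel_set p X {} \<in> hom (relcycle_group p X {}) (homology_group (int p) X)"
  using normal.r_coset_hom_Mod[OF normal_subgroup_singular_relboundary_relcycle[of p X "{}"]]
  by (simp add: right_coset_singular_relboundary relative_homology_group_def)

lemma loop_class_eq: "loop_class m g = homologous_rel_set 1 (elliptic_curve m) {} (loop_chain g)"
  by (simp add: loop_class_def cycle_class_def)

text \<open>A chain homologous to a cycle is a cycle, so membership of the class in the homology
  group takes the place of a boundary computation.\<close>

lemma singular_relcycle_loop_chain: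
  assumes "loop_class m g \<in> carrier (Gam m)"
  shows "singular_relcycle 1 (elliptic_curve m) {} (loop_chain g)"
proof -
  obtain z where z: "singular_relcycle 1 (elliptic_curve m) {} z"
    "homologous_rel_set 1 (elliptic_curve m) {} (loop_chain g) = homologous_rel_set 1 (elliptic_curve m) {} z"
    using assms carrier_relative_homology_group[of 1 "elliptic_curve m" "{}"] by (auto simp: loop_class_eq)
  then have "homologous_rel 1 (elliptic_curve m) {} (loop_chain g) z"
    using homologous_rel_set_eq by blast
  then show ?thesis
    using homologous_rel_singular_relcycle z(1) by blast
qed

lemma int_pow_relcycle_group:
  assumes "singular_relcycle p X S c"
  shows "c [^]\<^bsub>relcycle_group p X S\<^esub> (n::int) = frag_cmul n c"
proof -
  have "c \<in> carrier (relcycle_group p X S)" using assms by simp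
  then have "c [^]\<^bsub>relcycle_group p X S\<^esub> n = c [^]\<^bsub>chain_group p X\<^esub> n"
    unfolding relcycle_group_def by (rule group.int_pow_subgroup_generated[OF group_chain_group])
  also have "\<dots> = frag_cmul n c"
    using assms by (simp add: chain_group_def singular_relcycle_def singular_chain_def)
  finally show ?thesis .
qed

text \<open>Passing to classes is a homomorphism and multiples of a cycle are its powers in the
  cycle group. An expression of a class in the basis thereby yields an explicit representing
  cycle.\<close>

lemma cycle_class_two_loops:
  assumes g: "loop_class m g \<in> carrier (Gam m)" and h: "loop_class m h \<in> carrier (Gam m)"
  shows "cycle_class m (frag_cmul k (frag_of g) + frag_cmul l (frag_of h))
      = (loop_class m g [^]\<^bsub>Gam m\<^esub> k) \<otimes>\<^bsub>Gam m\<^esub> (loop_class m h [^]\<^bsub>Gam m\<^esub> l)"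
proof -
  let ?R = "relcycle_group 1 (elliptic_curve m) {}" and ?H = "homologous_rel_set 1 (elliptic_curve m) {}"
  have hom: "?H \<in> hom ?R (Gam m)"
    using homologous_rel_set_hom[of 1 "elliptic_curve m"] by simp
  have pow: "?H (frag_cmul n (loop_chain g)) = loop_class m g [^]\<^bsub>Gam m\<^esub> n
      \<and> frag_cmul n (loop_chain g) \<in> carrier ?R"
    if "loop_class m g \<in> carrier (Gam m)" for g and n :: int
  proof -
    have c: "singular_relcycle 1 (elliptic_curve m) {} (loop_chain g)"
      by (rule singular_relcycle_loop_chain[OF that])
    have "loop_chain g [^]\<^bsub>?R\<^esub> n \<in> carrier ?R"
      using c by (intro group.int_pow_closed) auto
    moreover have "?H (loop_chain g [^]\<^bsub>?R\<^esub> n) = loop_class m g [^]\<^bsub>Gam m\<^esub> n"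
      unfolding loop_class_eq using c by (intro hom_int_pow[OF hom]) auto
    ultimately show ?thesis unfolding int_pow_relcycle_group[OF c] by simp
  qed
  have "cycle_class m (frag_cmul k (frag_of g) + frag_cmul l (frag_of h))
      = ?H (frag_cmul k (loop_chain g) \<otimes>\<^bsub>?R\<^esub> frag_cmul l (loop_chain h))"
    by (simp add: cycle_class_def frag_extend_add frag_extend_cmul)
  also have "\<dots> = ?H (frag_cmul k (loop_chain g)) \<otimes>\<^bsub>Gam m\<^esub> ?H (frag_cmul l (loop_chain h))"
    by (rule hom_mult[OF hom]) (use pow[OF g] pow[OF h] in auto)
  finally show ?thesis using pow[OF g] pow[OF h] by simp
qed

lemma cycle_integral_add: "cycle_integral f (c + d) = cycle_integral f c + cycle_integral f d"
proof -
  \<comment> \<open>All three integrals are summed over the union of the key sets, since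
    coefficients may cancel in \<open>c + d\<close>.\<close>
  have *: "cycle_integral f b = (\<Sum>g\<in>Poly_Mapping.keys c \<union> Poly_Mapping.keys d.
        of_int (Poly_Mapping.lookup b g) * curve_integral f g)"
    if "Poly_Mapping.keys b \<subseteq> Poly_Mapping.keys c \<union> Poly_Mapping.keys d" for b
    unfolding cycle_integral_def
    by (rule sum.mono_neutral_left) (use that in \<open>auto simp: in_keys_iff\<close>)
  have "Poly_Mapping.keys (c + d) \<subseteq> Poly_Mapping.keys c \<union> Poly_Mapping.keys d"
    by (rule Poly_Mapping.keys_add)
  then show ?thesis
    by (simp add: * lookup_add distrib_right sum.distrib)
qed

lemma cycle_integral_cmul_of: "cycle_integral f (frag_cmul n (frag_of g)) = of_int n * curve_integral f g"
proof (cases "n = 0")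
  case False
  then have "Poly_Mapping.keys (frag_cmul n (frag_of g)) = {g}"
    by (auto simp: keys_cmul_iff)
  then show ?thesis by (simp add: cycle_integral_def)
qed (simp add: cycle_integral_def)

text \<open>The representatives demanded by \<open>Theta\<close> can be taken to be integer
  combinations of the two frame loops, which are anti-invariant and avoid x = q. Points with these
  fibre co-ordinates thus lie in the image of the embedding, where the value of the Joyce function
  is prescribed.\<close>

lemma Theta_torus_point:
  assumes pf: "period_frame U c" "m \<in> U"
    and q: "\<And>i t. t \<in> {0..1} \<Longrightarrow> c i m t $ 1 \<noteq> q"
    and \<theta>: "\<And>i. \<theta>$i = - curve_integral (\<lambda>P. (p / (P$1 - q) + r) / (2 * P$2)) (c i m)"
  shows "Theta (m$1, m$2, q, p, r) (torus_point c m \<theta>)"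
proof -
  let ?f = "\<lambda>P::complex^2. (p / (P$1 - q) + r) / (2 * P$2)" and ?e = "\<lambda>i. loop_class m (c i m)"
  have m: "vector [m$1, m$2] = m"
    by (simp add: vec_eq_iff forall_2)
  have car: "?e i \<in> carrier (Gam m)" for i by (rule period_frameD(5)[OF pf])
  have "\<exists>d. (\<forall>g\<in>Poly_Mapping.keys d. curve_loop m g \<and> anti_invariant g \<and> (\<forall>P\<in>path_image g. P$1 \<noteq> q)) \<and>
        cycle_class m d = \<gamma> \<and> torus_point c m \<theta> \<gamma> = exp (- cycle_integral ?f d)"
    if \<gamma>: "\<gamma> \<in> carrier (Gam m)" for \<gamma>
  proof -
    obtain n :: "int^2" where n: "\<gamma> = (?e 1 [^]\<^bsub>Gam m\<^esub> n$1) \<otimes>\<^bsub>Gam m\<^esub> (?e 2 [^]\<^bsub>Gam m\<^esub> n$2)"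
      using period_frameD(7)[OF pf \<gamma>] by blast
    define d where "d = frag_cmul (n$1) (frag_of (c 1 m)) + frag_cmul (n$2) (frag_of (c 2 m))"
    have "Poly_Mapping.keys d \<subseteq> {c 1 m, c 2 m}"
      unfolding d_def by (rule order_trans[OF Poly_Mapping.keys_add]) (auto simp: keys_cmul_iff split: if_splits)
    moreover have "curve_loop m (c i m) \<and> anti_invariant (c i m) \<and> (\<forall>P\<in>path_image (c i m). P$1 \<noteq> q)" for i
      using period_frameD(4,6)[OF pf] q by (auto simp: path_image_def)
    ultimately have 1: "\<forall>g\<in>Poly_Mapping.keys d. curve_loop m g \<and> anti_invariant g \<and> (\<forall>P\<in>path_image g. P$1 \<noteq> q)"
      by blast
    have 2: "cycle_class m d = \<gamma>"
      unfolding d_def n by (rule cycle_class_two_loops[OF car car])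
    have hom: "torus_point c m \<theta> \<in> hom (Gam m) Cstar"
      using torus_point_in_torus[OF pf] by (simp add: torus_def)
    have "torus_point c m \<theta> \<gamma> = exp (\<theta>$1) powi (n$1) * exp (\<theta>$2) powi (n$2)"
    proof -
      have pow: "torus_point c m \<theta> (?e i [^]\<^bsub>Gam m\<^esub> k) = exp (\<theta>$i) powi k" for i and k :: int
        using hom_int_pow[OF hom car group_relative_homology_group group_Cstar]
        by (simp add: torus_point_loop_class[OF pf] int_pow_Cstar)
      have "torus_point c m \<theta> \<gamma> = torus_point c m \<theta> (?e 1 [^]\<^bsub>Gam m\<^esub> n$1)
          \<otimes>\<^bsub>Cstar\<^esub> torus_point c m \<theta> (?e 2 [^]\<^bsub>Gam m\<^esub> n$2)"
        unfolding n by (intro hom_mult[OF hom] group.int_pow_closed group_relative_homology_group car)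
      then show ?thesis unfolding pow by (simp add: Cstar_def)
    qed
    also have "\<dots> = exp (of_int (n$1) * \<theta>$1 + of_int (n$2) * \<theta>$2)"
      unfolding exp_power_int exp_add ..
    also have "of_int (n$1) * \<theta>$1 + of_int (n$2) * \<theta>$2 = - cycle_integral ?f d"
      unfolding d_def cycle_integral_add cycle_integral_cmul_of \<theta> by simp
    finally show ?thesis using 1 2 by blast
  qed
  then show ?thesis
    unfolding Theta_def by (simp add: Let_def m torus_point_in_torus[OF pf])
qed

section \<open>The cubic part of the Joyce function\<close>

text \<open>Gathers what the loops contribute to the rest of the argument: the derivatives of the
  periods, the Euler relation and the third-kind expansion. The constants are made common to both
  loops by a sum for \<open>M\<close> and a maximum for \<open>Q\<close>.\<close>

lemma period_frame_periods:
  assumes pf: "period_frame U c" "m \<in> U"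
  obtains om et :: "complex^2" and M Q where
    "\<And>i X. dperiod c i m X = X$1 * et$i + X$2 * om$i"
    "\<And>i. period c i m = 4 * m$1 / 5 * et$i + 6 * m$2 / 5 * om$i"
    "M \<ge> 0" "\<And>i t q. norm q \<ge> Q \<Longrightarrow> t \<in> {0..1} \<Longrightarrow> c i m t $ 1 \<noteq> q"
    "\<And>i p q r. norm q \<ge> Q \<Longrightarrow>
       norm (- curve_integral (\<lambda>P. (p / (P$1 - q) + r) / (2 * P$2)) (c i m)
        - ((p / q - r) * om$i + p / q^2 * et$i - p / q^3 * (m$1 / 3) * om$i)) \<le> M * norm p / norm q ^ 4"
proof -
  note fam = period_frameD(1)[OF pf] and U = period_frameD(2,3)[OF pf] pf(2)
  have "\<exists>c'. continuous_on (U \<times> {0..1}) (\<lambda>(m,t). c' m t) \<and>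
      (\<forall>m\<in>U. \<forall>t\<in>{0..1}. (c i m has_vector_derivative c' m t) (at t within {0..1}))" for i
    using fam[of i] unfolding loop_family_def by blast
  then obtain c' where c': "\<And>i. continuous_on (U \<times> {0..1}) (\<lambda>(m,t). c' i m t)"
    "\<And>i m t. m \<in> U \<Longrightarrow> t \<in> {0..1} \<Longrightarrow> (c i m has_vector_derivative c' i m t) (at t within {0..1})"
    by metis
  have loop: "smooth_curve_loop m (c i m) (c' i m)" for i
    by (rule smooth_curve_loop_family[OF fam U(2,3) c'])
  define om where "om = (\<chi> i. smooth_curve_loop.omega m (c i m) (c' i m))"
  define et where "et = (\<chi> i. smooth_curve_loop.eta m (c i m) (c' i m))"
  have "((\<lambda>s. period c i (m + axis k s)) has_field_derivative (if k = 1 then et$i else om$i)) (at 0)" for i k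
    using DERIV_curve_integral_ydx[OF fam U c', of i k]
    by (cases "k = 1")
       (simp_all add: period_def om_def et_def smooth_curve_loop.omega_def[OF loop] smooth_curve_loop.eta_def[OF loop])
  then have "pderiv_at k (period c i) m = (if k = 1 then et$i else om$i)" for i k
    unfolding pderiv_at_def by (rule DERIV_imp_deriv)
  then have 1: "dperiod c i m X = X$1 * et$i + X$2 * om$i" for i X
    by (simp add: dperiod_def sum_2)
  have 2: "period c i m = 4 * m$1 / 5 * et$i + 6 * m$2 / 5 * om$i" for i
    by (simp add: period_def om_def et_def smooth_curve_loop.curve_integral_ydx[OF loop])
  define X where "X = (\<lambda>i p q r. - curve_integral (\<lambda>P. (p / (P$1 - q) + r) / (2 * P$2)) (c i m)
        - ((p / q - r) * om$i + p / q^2 * et$i - p / q^3 * (m$1 / 3) * om$i))"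
  have "\<exists>M Q. M \<ge> 0 \<and> (\<forall>q. norm q \<ge> Q \<longrightarrow> (\<forall>t\<in>{0..1}. c i m t $ 1 \<noteq> q) \<and>
       (\<forall>p r. norm (X i p q r) \<le> M * norm p / norm q ^ 4))" for i
    unfolding X_def om_def et_def vec_lambda_beta
    using smooth_curve_loop.third_kind_expansion[OF loop[of i]] by fast
  then obtain M Q where MQ: "\<And>i. M i \<ge> 0 \<and> (\<forall>q. norm q \<ge> Q i \<longrightarrow> (\<forall>t\<in>{0..1}. c i m t $ 1 \<noteq> q) \<and>
       (\<forall>p r. norm (X i p q r) \<le> M i * norm p / norm q ^ 4))"
    by metis
  have M: "M i \<ge> 0" for i using MQ by blast
  have ne: "c i m t $ 1 \<noteq> q" if "norm q \<ge> Q i" "t \<in> {0..1}" for i t q using MQ that by blast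
  have ex: "norm (- curve_integral (\<lambda>P. (p / (P$1 - q) + r) / (2 * P$2)) (c i m)
        - ((p / q - r) * om$i + p / q^2 * et$i - p / q^3 * (m$1 / 3) * om$i)) \<le> M i * norm p / norm q ^ 4"
    if "norm q \<ge> Q i" for i p q r
    using MQ that unfolding X_def by blast
  have le: "M i \<le> M 1 + M 2" "Q i \<le> max (Q 1) (Q 2)" for i
    using exhaust_2[of i] M[of 1] M[of 2] by auto
  show ?thesis
  proof (rule that[of et om "M 1 + M 2" "max (Q 1) (Q 2)"])
    show "0 \<le> M 1 + M 2" using M[of 1] M[of 2] by simp
    fix i and p q r :: complex assume "norm q \<ge> max (Q 1) (Q 2)"
    then have "norm q \<ge> Q i" using le order_trans by blast
    from ex[OF this, of p r] show "norm (- curve_integral (\<lambda>P. (p / (P$1 - q) + r) / (2 * P$2)) (c i m)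
        - ((p / q - r) * om$i + p / q^2 * et$i - p / q^3 * (m$1 / 3) * om$i)) \<le> (M 1 + M 2) * norm p / norm q ^ 4"
      by (rule order_trans) (intro divide_right_mono mult_right_mono le, auto)
  next
    fix i and q :: complex and t :: real assume "norm q \<ge> max (Q 1) (Q 2)" "t \<in> {0..1}"
    then show "c i m t $ 1 \<noteq> q" using ne le order_trans by blast
  qed (use 1 2 in auto)
qed

lemma A2_Joyce_function_on_W:
  assumes "A2_Joyce_function J" "(a,b,q,p,r) \<in> W_space" "Theta (a,b,q,p,r) \<xi>"
  shows "1 / (2 * of_real pi * \<i>) * J (vector [a,b]) \<xi> =
          - (1 / (4 * (4*a^3 + 27*b^2) * p)) *
            (2*a*p^2 + 3*p*(3*b - 2*a*q)*r + (6*a*q^2 - 9*b*q + 4*a^2)*r^2 - 2*a*p*r^3)"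
  using assms(1)[unfolded A2_Joyce_function_def, THEN conjunct2, rule_format, OF assms(2,3)] .

text \<open>Joint holomorphy in base point and fibre co-ordinate restricts to the fibre over
  \<open>m\<close>: the derivative is evaluated on vertical vectors \<open>(0, v)\<close>.\<close>

lemma A2_Joyce_function_holomorphic_0:
  assumes J: "A2_Joyce_function J" and pf: "period_frame U c" "m \<in> U"
  obtains S where "open S" "0 \<in> S" "holomorphic_map (*s) (*) (\<lambda>\<theta>. J m (torus_point c m \<theta>)) S"
proof -
  let ?F = "\<lambda>(m,\<theta>). J m (torus_point c m \<theta>)"
  obtain N where N: "open N" "(m,0) \<in> N" and hol: "holomorphic4 ?F N"
    using assms(1)[unfolded A2_Joyce_function_def, THEN conjunct1, rule_format, OF pf(1), THEN conjunct2, rule_format, OF pf(2)]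
    by blast
  define S where "S = Pair m -` N"
  have "open S"
    unfolding S_def using N(1) by (intro open_vimage continuous_intros)
  moreover have "0 \<in> S" using N(2) by (simp add: S_def)
  moreover have "holomorphic_map (*s) (*) (\<lambda>\<theta>. J m (torus_point c m \<theta>)) S"
    unfolding holomorphic_map_def
  proof
    fix \<theta> assume "\<theta> \<in> S"
    then obtain f' where f': "(?F has_derivative f') (at (m, \<theta>))" and lin: "\<And>c v. f' (scale_pair c v) = c * f' v"
      using hol unfolding holomorphic_map_def S_def by blast
    have "((\<lambda>\<theta>. (m, \<theta>)) has_derivative (\<lambda>v. (0, v))) (at \<theta>)"
      by (intro has_derivative_Pair has_derivative_const has_derivative_ident)
    from has_derivative_compose[OF this f']
    have "((\<lambda>\<theta>. J m (torus_point c m \<theta>)) has_derivative (\<lambda>v. f' (0, v))) (at \<theta>)" by simp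
    moreover have "f' (0, c *s v) = c * f' (0, v)" for c v
      using lin[of c "(0, v)"] by (simp add: scale_pair_def)
    ultimately show "\<exists>f'. ((\<lambda>\<theta>. J m (torus_point c m \<theta>)) has_derivative f') (at \<theta>) \<and> (\<forall>c v. f' (c *s v) = c * f' v)"
      by blast
  qed
  ultimately show ?thesis using that by blast
qed

section \<open>Expansion of the Joyce function at the zero section\<close>

text \<open>\<open>q\<close> and \<open>p\<close> parametrize the curve near infinity, and the poles
  of the separate terms at \<open>t = 0\<close> cancel by the curve equation. Keeping
  \<open>s\<close> makes the formula exact and leaves truncation to a later limit.\<close>

lemma Joyce_polynomial_on_curve:
  fixes a b k s t :: complex
  assumes "t \<noteq> 0" "s \<noteq> 0" and s: "s^2 = 1 + a * t^4 + b * t^6"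
  defines "q \<equiv> 1 / t^2" and "p \<equiv> s / t^3" and "r \<equiv> s / t - k * t"
  shows "(2*a*p^2 + 3*p*(3*b - 2*a*q)*r + (6*a*q^2 - 9*b*q + 4*a^2)*r^2 - 2*a*p*r^3) / p
    = 2*a^2 * t * s - 2*a*b * t^3 * s + k*t*(9*b - 2*a^2*t^2 + 6*a*b*t^4)
      - k^2*t^3*(9*b + 2*a^2*t^2 + 6*a*b*t^4) / s + 2*a*k^3*t^3" (is "?N / p = ?F")
proof -
  have "p \<noteq> 0" using assms by (simp add: p_def)
  \<comment> \<open>The difference is a multiple of the curve relation between \<open>s\<close> and
    \<open>t\<close>; the middle factor times \<open>p\<close> is the quotient.\<close>
  have "?N - ?F * p = (s^2 - (1 + a * t^4 + b * t^6)) * (- 2 * a * s / t^3 + 6 * a * k / t - 6 * a * k^2 * t / s) * p"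
    using assms(1,2) unfolding p_def q_def r_def
    by (simp add: field_simps eval_nat_numeral)
  then have "?N - ?F * p = 0" unfolding s by simp
  then show ?thesis using \<open>p \<noteq> 0\<close> by (simp add: field_simps)
qed

lemma cubic_coefficients_unique:
  fixes c0 c1 c2 c3 :: complex
  assumes "\<And>k. c0 + c1 * k + c2 * k^2 + c3 * k^3 = d0 + d1 * k + d2 * k^2 + d3 * k^3"
  shows "c0 = d0" "c1 = d1" "c2 = d2" "c3 = d3"
proof -
  have 0: "c0 = d0" using assms[of 0] by simp
  have 1: "c1 + c2 + c3 = d1 + d2 + d3" using assms[of 1] 0 by (simp add: add.assoc)
  have 2: "- c1 + c2 - c3 = - d1 + d2 - d3" using assms[of "-1"] 0 by (simp add: algebra_simps)
  have 3: "2 * c1 + 4 * c2 + 8 * c3 = 2 * d1 + 4 * d2 + 8 * d3" using assms[of 2] 0 by (simp add: algebra_simps)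
  have c2: "c2 = d2"
  proof -
    have "2 * c2 = 2 * d2" using arg_cong2[OF 1 2, of "(+)"] by (simp add: algebra_simps)
    then show ?thesis by simp
  qed
  have 4: "c1 + c3 = d1 + d3" using 1 c2 by (simp add: algebra_simps)
  have 5: "2 * c1 + 8 * c3 = 2 * d1 + 8 * d3" using 3 c2 by (simp add: algebra_simps)
  have "6 * c3 = 6 * d3"
  proof -
    have "6 * c3 = (2 * c1 + 8 * c3) - 2 * (c1 + c3)" by simp
    also have "\<dots> = 6 * d3" unfolding 4 5 by simp
    finally show ?thesis .
  qed
  then have c3: "c3 = d3" by simp
  show "c0 = d0" "c1 = d1" "c2 = d2" "c3 = d3" using 0 4 c2 c3 by auto
qed

lemma deriv_cubic:
  fixes \<alpha> \<beta> :: complex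
  shows "deriv (\<lambda>t. \<alpha> * t + \<beta> * t^3) 0 = \<alpha>" "(deriv ^^ 3) (\<lambda>t. \<alpha> * t + \<beta> * t^3) 0 = 6 * \<beta>"
proof -
  have 1: "deriv (\<lambda>t. \<alpha> * t + \<beta> * t^3) = (\<lambda>t. \<alpha> + 3 * \<beta> * t^2)"
    by (intro ext DERIV_imp_deriv) (auto intro!: derivative_eq_intros)
  have 2: "deriv (\<lambda>t. \<alpha> + 3 * \<beta> * t^2) = (\<lambda>t. 6 * \<beta> * t)"
    by (intro ext DERIV_imp_deriv) (auto intro!: derivative_eq_intros)
  have 3: "deriv (\<lambda>t. 6 * \<beta> * t) = (\<lambda>t. 6 * \<beta>)"
    by (intro ext DERIV_imp_deriv) (auto intro!: derivative_eq_intros)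
  show "deriv (\<lambda>t. \<alpha> * t + \<beta> * t^3) 0 = \<alpha>" "(deriv ^^ 3) (\<lambda>t. \<alpha> * t + \<beta> * t^3) 0 = 6 * \<beta>"
  proof -
    have "(deriv ^^ 3) h = deriv (deriv (deriv h))" for h :: "complex \<Rightarrow> complex"
      by (simp add: numeral_3_eq_3)
    then show "(deriv ^^ 3) (\<lambda>t. \<alpha> * t + \<beta> * t^3) 0 = 6 * \<beta>" by (simp only: 1 2 3)
  qed (simp add: 1)
qed

text \<open>\<open>derivs_0_of_bigo\<close> is applied to the difference. Only \<open>g\<close> has
  to be holomorphic, so the estimate may pass through functions about which nothing but their size
  near 0 is known.\<close>

lemma derivs_eq_of_bigo:
  fixes g :: "complex \<Rightarrow> complex"
  assumes g: "g holomorphic_on ball 0 e" "e > 0"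
    and O: "(\<lambda>t. g t - (\<alpha> * t + \<beta> * t^3)) \<in> O[at 0](\<lambda>t. t^4)"
  shows "deriv g 0 = \<alpha>" "(deriv ^^ 3) g 0 = 6 * \<beta>"
proof -
  obtain K where "\<forall>\<^sub>F t in at 0. norm (g t - (\<alpha> * t + \<beta> * t^3)) \<le> K * norm (t^4)"
    using O by (auto elim: landau_o.bigE)
  then obtain e' where e': "e' > 0" "\<And>t. t \<noteq> 0 \<Longrightarrow> norm t < e' \<Longrightarrow> norm (g t - (\<alpha> * t + \<beta> * t^3)) \<le> K * norm t ^ 4"
    by (auto simp: eventually_at norm_power)
  define d where "d = min e e'"
  have d: "d > 0" using g(2) e'(1) by (simp add: d_def)
  have hg: "g holomorphic_on ball 0 d" by (rule holomorphic_on_subset[OF g(1)]) (auto simp: d_def)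
  have hp: "(\<lambda>t. \<alpha> * t + \<beta> * t^3) holomorphic_on ball 0 d" by (intro holomorphic_intros)
  have *: "(deriv ^^ k) g 0 = (deriv ^^ k) (\<lambda>t. \<alpha> * t + \<beta> * t^3) 0" if "k < 4" for k
  proof -
    have "(deriv ^^ k) (\<lambda>t. g t - (\<alpha> * t + \<beta> * t^3)) 0 = 0"
      by (rule derivs_0_of_bigo[OF holomorphic_on_diff[OF hg hp] d _ that, of K])
         (use e'(2) in \<open>auto simp: d_def\<close>)
    then show ?thesis
      using higher_deriv_diff[OF hg hp open_ball, of 0 k] d by simp
  qed
  show "deriv g 0 = \<alpha>" using *[of 1] deriv_cubic(1) by simp
  show "(deriv ^^ 3) g 0 = 6 * \<beta>" using *[of 3] deriv_cubic(2) by simp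
qed


text \<open>At the exact points \<theta>(t) of the image of the embedding the Joyce function is
  explicit. The cubic polynomial \<gamma>(t) differs from \<theta>(t) by O(t^5), so by the Lipschitz
  bound the explicit value determines the jet of order three along \<gamma>, where the composite is
  known to be holomorphic.\<close>

lemma Joyce_function_jet:
  fixes J :: "complex^2 \<Rightarrow> ((complex^2) option chain set \<Rightarrow> complex) \<Rightarrow> complex"
    and om et :: "complex^2" and k :: complex
  assumes J: "A2_Joyce_function J" and pf: "period_frame U c" "m \<in> U"
    and ne: "\<And>i t q. norm q \<ge> Q \<Longrightarrow> t \<in> {0..1} \<Longrightarrow> c i m t $ 1 \<noteq> q"
    and ex: "\<And>i p q r. norm q \<ge> Q \<Longrightarrow>
       norm (- curve_integral (\<lambda>P. (p / (P$1 - q) + r) / (2 * P$2)) (c i m)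
        - ((p / q - r) * om$i + p / q^2 * et$i - p / q^3 * (m$1 / 3) * om$i)) \<le> M * norm p / norm q ^ 4"
    and M: "M \<ge> 0"
    and f: "holomorphic_map (*s) (*) (\<lambda>\<theta>. J m (torus_point c m \<theta>)) S" and S: "open S" "0 \<in> S"
  defines "g \<equiv> \<lambda>t. J m (torus_point c m (t *s (k *s om + et) + t^3 *s ((- m$1 / 3) *s om)))"
    and "A \<equiv> - (2 * of_real pi * \<i>) / (4 * disc m)"
  shows "deriv g 0 = A * (2 * (m$1)^2 + 9 * m$2 * k)"
    and "(deriv ^^ 3) g 0 = 6 * (A * (- 2 * m$1 * m$2 - 2 * (m$1)^2 * k - 9 * m$2 * k^2 + 2 * m$1 * k^3))"
proof -
  define a b where "a = m$1" and "b = m$2"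
  define f where "f = (\<lambda>\<theta>. J m (torus_point c m \<theta>))"
  have hol_f: "holomorphic_map (*s) (*) f S"
    using assms(7) by (simp add: f_def)
  define \<gamma> where "\<gamma> = (\<lambda>t. t *s (k *s om + et) + t^3 *s ((- m$1 / 3) *s om))"
  \<comment> \<open>The principal root satisfies the curve equation for every \<open>t\<close> and
    tends to 1. Its real part is nonnegative, so \<open>s t + 1\<close> never vanishes.\<close>
  define s where "s = (\<lambda>t. csqrt (1 + a * t^4 + b * t^6))"
  define q where "q = (\<lambda>t::complex. 1 / t^2)"
  define p where "p = (\<lambda>t. s t / t^3)"
  define r where "r = (\<lambda>t. s t / t - k * t)"
  \<comment> \<open>s = 1 + \<rho> t^4 with \<rho> convergent, so \<open>s\<close> may be replaced
    by 1 in the leading terms.\<close>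
  define \<rho> where "\<rho> = (\<lambda>t. (s t - 1) / t^4)"
  have s2: "(s t)^2 = 1 + a * t^4 + b * t^6" for t
    by (simp add: s_def)
  have s_lim: "(s \<longlongrightarrow> 1) (at 0)"
  proof -
    have "((\<lambda>t. 1 + a * t^4 + b * t^6) \<longlongrightarrow> 1 + a * 0^4 + b * 0^6) (at 0)"
      by (intro tendsto_intros)
    then have "((\<lambda>t. 1 + a * t^4 + b * t^6) \<longlongrightarrow> 1) (at 0)" by simp
    from isCont_tendsto_compose[OF _ this, of csqrt] show ?thesis
      unfolding s_def by (simp add: continuous_at_csqrt)
  qed
  have s1: "s t + 1 \<noteq> 0" for t
  proof
    assume "s t + 1 = 0"
    then have "Re (s t) = - 1" by (simp add: add_eq_0_iff2)
    moreover have "Re (s t) \<ge> 0" unfolding s_def by (rule Re_csqrt)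
    ultimately show False by simp
  qed
  have s_bound: "\<forall>\<^sub>F t in at 0. norm (s t) \<le> 2"
    using order_tendstoD(2)[OF tendsto_norm[OF s_lim], of 2] by (auto elim: eventually_mono)
  have s_ne: "\<forall>\<^sub>F t in at 0. s t \<noteq> 0"
    by (rule tendsto_imp_eventually_ne[OF s_lim]) simp
  have t_ne: "\<forall>\<^sub>F t in at 0. (t::complex) \<noteq> 0"
    by (simp add: eventually_at_filter)
  have \<rho>_lim: "(\<rho> \<longlongrightarrow> a / 2) (at 0)"
  proof (rule Lim_transform_eventually)
    have "((\<lambda>t. (a + b * t^2) / (s t + 1)) \<longlongrightarrow> (a + b * 0^2) / (1 + 1)) (at 0)"
      by (intro tendsto_intros s_lim) simp
    then show "((\<lambda>t. (a + b * t^2) / (s t + 1)) \<longlongrightarrow> a / 2) (at 0)" by simp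
    show "\<forall>\<^sub>F t in at 0. (a + b * t^2) / (s t + 1) = \<rho> t"
      using t_ne
    proof eventually_elim
      case (elim t)
      have "(s t - 1) * (s t + 1) = (a + b * t^2) * t^4"
        using s2[of t] by (simp add: algebra_simps power2_eq_square eval_nat_numeral)
      then show ?case using elim s1[of t] by (simp add: \<rho>_def divide_simps)
    qed
  qed
  have q_large: "\<forall>\<^sub>F t in at 0. norm (q t) \<ge> Q"
  proof -
    have "norm (q t) \<ge> Q" if t: "t \<noteq> 0" "norm t < 1 / (\<bar>Q\<bar> + 1)" for t
    proof -
      have "norm t * (\<bar>Q\<bar> + 1) \<le> 1" using t(2) by (simp add: field_simps)
      moreover have "norm t \<le> norm t * (\<bar>Q\<bar> + 1)" by (simp add: algebra_simps)
      ultimately have "norm t * (norm t * (\<bar>Q\<bar> + 1)) \<le> 1 * 1" by (intro mult_mono) auto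
      then have "(\<bar>Q\<bar> + 1) \<le> norm (q t)"
        using t(1) by (simp add: q_def norm_divide norm_mult field_simps power2_eq_square)
      then show ?thesis by linarith
    qed
    then show ?thesis
      unfolding eventually_at by (intro exI[of _ "1 / (\<bar>Q\<bar> + 1)"]) auto
  qed
  define \<theta> where "\<theta> = (\<lambda>t. \<chi> i. - curve_integral (\<lambda>P. (p t / (P$1 - q t) + r t) / (2 * P$2)) (c i m))"
  \<comment> \<open>Two errors of order five: the remainder M|p|/|q|^4, as p is of order t^(-3) and
    q = t^(-2), and the error of replacing \<open>s\<close> by 1 in terms that carry at least one
    factor \<open>t\<close>.\<close>
  have close: "(\<lambda>t. (\<theta> t - \<gamma> t) $ i) \<in> O[at 0](\<lambda>t. t^5)" for i
  proof -
    define E where "E = (\<lambda>t. \<theta> t $ i - ((p t / q t - r t) * om$i + p t / q t^2 * et$i - p t / q t^3 * (m$1 / 3) * om$i))"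
    have "E \<in> O[at 0](\<lambda>t. t^5)"
    proof (rule bigoI[of _ "M * 2"])
      show "\<forall>\<^sub>F t in at 0. norm (E t) \<le> M * 2 * norm (t^5)"
        using q_large s_bound t_ne
      proof eventually_elim
        case (elim t)
        have "norm (E t) \<le> M * norm (p t) / norm (q t) ^ 4"
          using ex[OF elim(1), of "p t" "r t" i] by (simp add: E_def \<theta>_def)
        also have "\<dots> = M * norm (s t) * norm (t^5)"
          using elim(3) by (simp add: p_def q_def norm_divide norm_mult field_simps eval_nat_numeral)
        also have "\<dots> \<le> M * 2 * norm (t^5)"
          using elim(2) M by (intro mult_mono) auto
        finally show ?case .
      qed
    qed
    moreover have "(\<lambda>t. (s t - 1) * (t * et$i - t^3 * (m$1 / 3) * om$i)) \<in> O[at 0](\<lambda>t. t^5)"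
    proof (rule bigoI_tendsto)
      show "((\<lambda>t. (s t - 1) * (t * et$i - t^3 * (m$1 / 3) * om$i) / t^5) \<longlongrightarrow> a / 2 * (et$i - 0^2 * (m$1 / 3) * om$i)) (at 0)"
      proof (rule Lim_transform_eventually)
        show "((\<lambda>t. \<rho> t * (et$i - t^2 * (m$1 / 3) * om$i)) \<longlongrightarrow> a / 2 * (et$i - 0^2 * (m$1 / 3) * om$i)) (at 0)"
          by (intro tendsto_intros \<rho>_lim)
        show "\<forall>\<^sub>F t in at 0. \<rho> t * (et$i - t^2 * (m$1 / 3) * om$i) = (s t - 1) * (t * et$i - t^3 * (m$1 / 3) * om$i) / t^5"
          using t_ne by eventually_elim (simp add: \<rho>_def field_simps eval_nat_numeral)
      qed
      show "\<forall>\<^sub>F t in at 0. t^5 \<noteq> (0::complex)" using t_ne by simp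
    qed
    ultimately have O: "(\<lambda>t. E t + (s t - 1) * (t * et$i - t^3 * (m$1 / 3) * om$i)) \<in> O[at 0](\<lambda>t. t^5)"
      by (rule sum_in_bigo)
    have "\<forall>\<^sub>F t in at 0. E t + (s t - 1) * (t * et$i - t^3 * (m$1 / 3) * om$i) = (\<theta> t - \<gamma> t) $ i"
      using t_ne
    proof eventually_elim
      case (elim t)
      then have eqs: "p t / q t - r t = k * t" "p t / q t^2 = s t * t" "p t / q t^3 = s t * t^3"
        by (simp_all add: p_def q_def r_def field_simps eval_nat_numeral)
      show ?case
        unfolding E_def eqs \<gamma>_def by (simp add: field_simps)
    qed
    from landau_o.big.in_cong[THEN iffD1, OF this O] show ?thesis .
  qed
  have "\<exists>K. \<forall>\<^sub>F t in at 0. norm ((\<theta> t - \<gamma> t) $ i) \<le> K * norm (t^5)" for i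
    using landau_o.bigE[OF close[of i]] by blast
  then obtain K where K: "\<And>i. \<forall>\<^sub>F t in at 0. norm ((\<theta> t - \<gamma> t) $ i) \<le> K i * norm (t^5)"
    by metis
  have K': "\<forall>\<^sub>F t in at 0. norm (\<theta> t - \<gamma> t) \<le> (K 1 + K 2) * norm (t^5)"
    using K[of 1] K[of 2]
  proof eventually_elim
    case (elim t)
    have "norm (\<theta> t - \<gamma> t) \<le> (\<Sum>i\<in>UNIV. norm ((\<theta> t - \<gamma> t) $ i))"
      unfolding norm_vec_def by (rule L2_set_le_sum) simp
    then show ?case using elim by (simp add: sum_2 algebra_simps)
  qed
  obtain R L where R: "R > 0" "L \<ge> 0" "ball 0 R \<subseteq> S"
    and Lip: "\<And>x y. x \<in> ball 0 R \<Longrightarrow> y \<in> ball 0 R \<Longrightarrow> norm (f x - f y) \<le> L * norm (x - y)"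
    by (rule holomorphic_map_locally_Lipschitz[OF hol_f S]) (rule that)
  have \<gamma>_lim: "((\<lambda>t. norm (\<gamma> t)) \<longlongrightarrow> 0) (at 0)"
  proof -
    have "continuous_on UNIV \<gamma>"
      unfolding \<gamma>_def vector_scalar_mult_def by (intro continuous_intros)
    then have "isCont \<gamma> 0" by (simp add: continuous_on_eq_continuous_at)
    then have "(\<gamma> \<longlongrightarrow> \<gamma> 0) (at 0)" by (simp add: isCont_def)
    then show ?thesis using tendsto_norm by (fastforce simp: \<gamma>_def)
  qed
  have bound_lim: "((\<lambda>t::complex. (K 1 + K 2) * norm (t^5)) \<longlongrightarrow> 0) (at 0)"
    by (auto intro!: tendsto_eq_intros)
  \<comment> \<open>The order five of the displacement is weakened to four, the order at which the
    third derivative is already determined.\<close>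
  have f_close: "(\<lambda>t. f (\<gamma> t) - f (\<theta> t)) \<in> O[at 0](\<lambda>t. t^4)"
  proof (rule bigoI[of _ "L * \<bar>K 1 + K 2\<bar>"])
    have "\<forall>\<^sub>F t in at 0. norm (t::complex) < 1"
      unfolding eventually_at by (intro exI[of _ 1]) auto
    moreover have "\<forall>\<^sub>F t in at 0. norm (\<gamma> t) < R / 2"
      by (rule order_tendstoD(2)[OF \<gamma>_lim]) (use R in simp)
    moreover have "\<forall>\<^sub>F t in at (0::complex). (K 1 + K 2) * norm (t^5) < R / 2"
      by (rule order_tendstoD(2)[OF bound_lim]) (use R in simp)
    ultimately show "\<forall>\<^sub>F t in at 0. norm (f (\<gamma> t) - f (\<theta> t)) \<le> L * \<bar>K 1 + K 2\<bar> * norm (t^4)"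
      using K'
    proof eventually_elim
      case (elim t)
      have "norm (\<theta> t) \<le> norm (\<gamma> t) + norm (\<theta> t - \<gamma> t)" by (rule norm_triangle_sub)
      then have "\<gamma> t \<in> ball 0 R" "\<theta> t \<in> ball 0 R" using elim R(1) by auto
      from Lip[OF this] have "norm (f (\<gamma> t) - f (\<theta> t)) \<le> L * norm (\<theta> t - \<gamma> t)"
        by (simp add: norm_minus_commute)
      also have "\<dots> \<le> L * (\<bar>K 1 + K 2\<bar> * norm (t^4))"
      proof (intro mult_left_mono R(2))
        have "norm (t^5) \<le> norm (t^4)"
          unfolding norm_power using elim(1) by (intro power_decreasing) auto
        then have "(K 1 + K 2) * norm (t^5) \<le> \<bar>K 1 + K 2\<bar> * norm (t^4)"
          by (intro mult_mono) auto
        then show "norm (\<theta> t - \<gamma> t) \<le> \<bar>K 1 + K 2\<bar> * norm (t^4)" using elim(4) by linarith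
      qed
      finally show ?case by (simp add: mult_ac)
    qed
  qed
  define F where "F = (\<lambda>t. 2*a^2 * t * s t - 2*a*b * t^3 * s t + k*t*(9*b - 2*a^2*t^2 + 6*a*b*t^4)
      - k^2*t^3*(9*b + 2*a^2*t^2 + 6*a*b*t^4) / s t + 2*a*k^3*t^3)"
  have disc: "disc m \<noteq> 0" "disc m = 4*a^3 + 27*b^2"
    using period_frameD(3)[OF pf] pf(2) by (auto simp: base_def disc_def a_def b_def)
  have m: "vector [a,b] = m" by (simp add: vec_eq_iff forall_2 a_def b_def)
  \<comment> \<open>Large \<open>q\<close> keeps the loops away from x = q, and a nonzero
    \<open>s\<close> gives a nonzero \<open>p\<close>, as membership in \<open>W_space\<close>
    demands.\<close>
  have f_val: "\<forall>\<^sub>F t in at 0. f (\<theta> t) = A * F t"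
    using q_large s_ne t_ne
  proof eventually_elim
    case (elim t)
    have "(s t / t^3)^2 = (1 / t^2)^3 + a * (1 / t^2) + b"
      using elim(3) s2[of t] by (simp add: field_simps eval_nat_numeral)
    then have W: "(a, b, q t, p t, r t) \<in> W_space"
      using elim disc by (simp add: W_space_def p_def q_def)
    have "Theta (m$1, m$2, q t, p t, r t) (torus_point c m (\<theta> t))"
      by (rule Theta_torus_point[OF pf ne[OF elim(1)]]) (auto simp: \<theta>_def)
    from A2_Joyce_function_on_W[OF J W this[folded a_def b_def]]
    have "1 / (2 * of_real pi * \<i>) * f (\<theta> t) = - (1 / (4 * disc m)) *
       ((2*a*(p t)^2 + 3*p t*(3*b - 2*a*q t)*r t + (6*a*(q t)^2 - 9*b*q t + 4*a^2)*(r t)^2 - 2*a*p t*(r t)^3) / p t)"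
      unfolding disc(2) f_def m by simp
    also have "(2*a*(p t)^2 + 3*p t*(3*b - 2*a*q t)*r t + (6*a*(q t)^2 - 9*b*q t + 4*a^2)*(r t)^2 - 2*a*p t*(r t)^3) / p t = F t"
      unfolding F_def p_def q_def r_def by (rule Joyce_polynomial_on_curve[OF elim(3,2) s2])
    finally have "1 / (2 * of_real pi * \<i>) * f (\<theta> t) = - (1 / (4 * disc m)) * F t" .
    then have "2 * of_real pi * \<i> * (1 / (2 * of_real pi * \<i>) * f (\<theta> t)) = 2 * of_real pi * \<i> * (- (1 / (4 * disc m)) * F t)"
      by (rule arg_cong)
    then show ?case by (simp add: A_def)
  qed
  define \<alpha> where "\<alpha> = A * (2 * a^2 + 9 * b * k)"
  define \<beta> where "\<beta> = A * (- 2 * a * b - 2 * a^2 * k - 9 * b * k^2 + 2 * a * k^3)"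
  have "(\<lambda>t. A * F t - (\<alpha> * t + \<beta> * t^3)) \<in> O[at 0](\<lambda>t. t^4)"
  proof (rule bigoI_tendsto)
    \<comment> \<open>The remainder divided by t^4, with \<open>s - 1\<close> rewritten through
      \<rho>: no negative power of \<open>t\<close> is left and every term carries a factor
      \<open>t\<close>, so the limit is 0.\<close>
    let ?h = "\<lambda>t. A * (2*a^2 * t * \<rho> t - 2*a*b * t^3 * \<rho> t + 6*a*b*k * t
        - k^2 * (2*a^2 * t + 6*a*b * t^3 - 9*b * t^3 * \<rho> t) / s t)"
    show "((\<lambda>t. (A * F t - (\<alpha> * t + \<beta> * t^3)) / t^4) \<longlongrightarrow> 0) (at 0)"
    proof (rule Lim_transform_eventually)
      have "(?h \<longlongrightarrow> A * (2*a^2 * 0 * (a / 2) - 2*a*b * 0^3 * (a / 2) + 6*a*b*k * 0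
        - k^2 * (2*a^2 * 0 + 6*a*b * 0^3 - 9*b * 0^3 * (a / 2)) / 1)) (at 0)"
        by (intro tendsto_intros \<rho>_lim s_lim) simp
      then show "(?h \<longlongrightarrow> 0) (at 0)" by simp
      show "\<forall>\<^sub>F t in at 0. ?h t = (A * F t - (\<alpha> * t + \<beta> * t^3)) / t^4"
        using s_ne t_ne
      proof eventually_elim
        case (elim t)
        have "\<rho> t * t^4 = s t - 1" using elim by (simp add: \<rho>_def)
        have "?h t * t^4 = A * (2*a^2 * t * (s t - 1) - 2*a*b * t^3 * (s t - 1) + 6*a*b*k * t^5
           - k^2 * (2*a^2 * t^5 + 6*a*b * t^7 - 9*b * t^3 * (s t - 1)) / s t)"
          unfolding \<open>\<rho> t * t^4 = s t - 1\<close>[symmetric] by (simp add: algebra_simps eval_nat_numeral add_divide_distrib diff_divide_distrib)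
        also have "\<dots> = A * F t - (\<alpha> * t + \<beta> * t^3)"
          unfolding F_def \<alpha>_def \<beta>_def using elim by (simp add: field_simps eval_nat_numeral)
        finally show ?case using elim by (simp add: field_simps)
      qed
    qed
    show "\<forall>\<^sub>F t in at 0. t^4 \<noteq> (0::complex)" using t_ne by simp
  qed
  from sum_in_bigo(1)[OF f_close this]
  have O1: "(\<lambda>t. (f (\<gamma> t) - f (\<theta> t)) + (A * F t - (\<alpha> * t + \<beta> * t^3))) \<in> O[at 0](\<lambda>t. t^4)" .
  have "\<forall>\<^sub>F t in at 0. (f (\<gamma> t) - f (\<theta> t)) + (A * F t - (\<alpha> * t + \<beta> * t^3)) = g t - (\<alpha> * t + \<beta> * t^3)"
    using f_val by eventually_elim (simp add: g_def f_def \<gamma>_def)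
  from landau_o.big.in_cong[THEN iffD1, OF this O1]
  have O: "(\<lambda>t. g t - (\<alpha> * t + \<beta> * t^3)) \<in> O[at 0](\<lambda>t. t^4)" .
  obtain e where "e > 0" "g holomorphic_on ball 0 e"
    using derivs_along_cubic_curve(1)[OF f S] unfolding g_def by blast
  from derivs_eq_of_bigo[OF this(2,1) O]
  show "deriv g 0 = A * (2 * (m$1)^2 + 9 * m$2 * k)"
    "(deriv ^^ 3) g 0 = 6 * (A * (- 2 * m$1 * m$2 - 2 * (m$1)^2 * k - 9 * m$2 * k^2 + 2 * m$1 * k^3))"
    by (simp_all add: \<alpha>_def \<beta>_def a_def b_def)
qed


text \<open>The fibre vector of X is \<open>X$1 *s et + X$2 *s om\<close>, so four values of the
  symmetric trilinear form on \<open>et\<close> and \<open>om\<close> suffice. They are the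
  coefficients in \<open>k\<close> of the third derivative along \<open>k *s om + et\<close>, once
  the contribution of the cubic term of the curve has been removed.\<close>

lemma
  fixes J :: "complex^2 \<Rightarrow> ((complex^2) option chain set \<Rightarrow> complex) \<Rightarrow> complex"
  assumes J: "A2_Joyce_function J" and pf: "period_frame U c" "m \<in> U"
  shows J3_trilinear:
    "(\<Sum>i\<in>UNIV. \<Sum>j\<in>UNIV. \<Sum>k\<in>UNIV.
        dperiod c i m X * dperiod c j m Y * dperiod c k m T * J3 J c m i j k)
     = - (3 * of_real pi * \<i>) / disc m *
       (m$1 * m$2 * (X$1 * Y$1 * T$1)
        - 2 * (m$1)^2 / 3 * (X$1 * Y$1 * T$2 + X$1 * Y$2 * T$1 + X$2 * Y$1 * T$1)
        - 3 * m$2 * (X$1 * Y$2 * T$2 + X$2 * Y$1 * T$2 + X$2 * Y$2 * T$1)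
        + 2 * m$1 * (X$2 * Y$2 * T$2))"
    and period_eq_dperiod_Euler: "period c i m = dperiod c i m (vector [4 * m$1 / 5, 6 * m$2 / 5])"
proof -
  obtain om et :: "complex^2" and M Q where
    dp: "\<And>i X. dperiod c i m X = X$1 * et$i + X$2 * om$i"
    and per: "\<And>i. period c i m = 4 * m$1 / 5 * et$i + 6 * m$2 / 5 * om$i"
    and M: "M \<ge> 0" and ne: "\<And>i t q. norm q \<ge> Q \<Longrightarrow> t \<in> {0..1} \<Longrightarrow> c i m t $ 1 \<noteq> q"
    and ex: "\<And>i p q r. norm q \<ge> Q \<Longrightarrow>
       norm (- curve_integral (\<lambda>P. (p / (P$1 - q) + r) / (2 * P$2)) (c i m)
        - ((p / q - r) * om$i + p / q^2 * et$i - p / q^3 * (m$1 / 3) * om$i)) \<le> M * norm p / norm q ^ 4"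
    by (rule period_frame_periods[OF pf]) (rule that)
  show "period c i m = dperiod c i m (vector [4 * m$1 / 5, 6 * m$2 / 5])"
    by (simp add: dp per)
  obtain S where S: "open S" "0 \<in> S" and f: "holomorphic_map (*s) (*) (\<lambda>\<theta>. J m (torus_point c m \<theta>)) S"
    by (rule A2_Joyce_function_holomorphic_0[OF J pf])
  define A where "A = - (2 * of_real pi * \<i>) / (4 * disc m)"
  define P where "P = (\<lambda>i. pderiv_at i (\<lambda>\<theta>. J m (torus_point c m \<theta>)) 0)"
  define D where "D = J3 J c m"
  have D: "D i j k = pderiv_at i (pderiv_at j (pderiv_at k (\<lambda>\<theta>. J m (torus_point c m \<theta>)))) 0" for i j k
    by (simp add: D_def J3_def)
  have sym: "D i j k = D j i k" "D i j k = D i k j" for i j k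
    unfolding D
    using pderiv_at_commute[OF holomorphic_map_pderiv_at[OF f S(1)] S] pderiv_at_commute3[OF f S] by auto
  have D': "D 1 2 1 = D 1 1 2" "D 2 1 1 = D 1 1 2" "D 2 1 2 = D 1 2 2" "D 2 2 1 = D 1 2 2"
    using sym by metis+
  have jet: "deriv (\<lambda>t. J m (torus_point c m (t *s (k *s om + et) + t^3 *s ((- m$1 / 3) *s om)))) 0
        = A * (2 * (m$1)^2 + 9 * m$2 * k)"
    "(deriv ^^ 3) (\<lambda>t. J m (torus_point c m (t *s (k *s om + et) + t^3 *s ((- m$1 / 3) *s om)))) 0
        = 6 * (A * (- 2 * m$1 * m$2 - 2 * (m$1)^2 * k - 9 * m$2 * k^2 + 2 * m$1 * k^3))" for k
    unfolding A_def
    by (rule Joyce_function_jet[where Q = Q, OF J pf _ _ M f S]; (rule ne ex; assumption))+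
  have j1: "(\<Sum>i\<in>UNIV. (k *s om + et)$i * P i) = A * (2 * (m$1)^2 + 9 * m$2 * k)" for k
    unfolding P_def jet(1)[of k, symmetric] by (rule derivs_along_cubic_curve(2)[OF f S, symmetric])
  have j3: "(\<Sum>i\<in>UNIV. \<Sum>j\<in>UNIV. \<Sum>l\<in>UNIV. (k *s om + et)$i * (k *s om + et)$j * (k *s om + et)$l * D i j l)
      + 6 * (\<Sum>i\<in>UNIV. ((- m$1 / 3) *s om)$i * P i)
      = 6 * (A * (- 2 * m$1 * m$2 - 2 * (m$1)^2 * k - 9 * m$2 * k^2 + 2 * m$1 * k^3))" for k
    unfolding P_def D jet(2)[of k, symmetric] by (rule derivs_along_cubic_curve(3)[OF f S, symmetric])
  \<comment> \<open>The first jets for \<open>k = 1\<close> and \<open>k = 0\<close> differ by the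
    gradient paired with \<open>om\<close>; this is what the cubic term of the curve contributes, up
    to a factor.\<close>
  have oP: "om$1 * P 1 + om$2 * P 2 = 9 * A * m$2"
  proof -
    have "om$1 * P 1 + om$2 * P 2 = (\<Sum>i\<in>UNIV. (1 *s om + et)$i * P i) - (\<Sum>i\<in>UNIV. (0 *s om + et)$i * P i)"
      by (simp add: sum_2 algebra_simps)
    then show ?thesis unfolding j1 by (simp add: algebra_simps)
  qed
  define tri where "tri = (\<lambda>x y z :: complex^2. \<Sum>i\<in>UNIV. \<Sum>j\<in>UNIV. \<Sum>k\<in>UNIV. x$i * y$j * z$k * D i j k)"
  \<comment> \<open>The cubic term of the curve adds \<open>- 18 * A * m$1 * m$2\<close> to the
    third derivative. Subtracting it turns the constant coefficient
    \<open>- 12 * A * m$1 * m$2\<close> into \<open>6 * A * m$1 * m$2\<close>.\<close>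
  have "tri et et et + (3 * tri et et om) * k + (3 * tri et om om) * k^2 + tri om om om * k^3
      = 6 * A * m$1 * m$2 + (- 12 * A * (m$1)^2) * k + (- 54 * A * m$2) * k^2 + (12 * A * m$1) * k^3" for k
  proof -
    have "(\<Sum>i\<in>UNIV. ((- m$1 / 3) *s om)$i * P i) = - m$1 / 3 * (om$1 * P 1 + om$2 * P 2)"
      by (simp add: sum_2 algebra_simps)
    also have "\<dots> = - 3 * A * m$1 * m$2" unfolding oP by simp
    finally have w: "(\<Sum>i\<in>UNIV. ((- m$1 / 3) *s om)$i * P i) = - 3 * A * m$1 * m$2" .
    have "tri et et et + (3 * tri et et om) * k + (3 * tri et om om) * k^2 + tri om om om * k^3
      = (\<Sum>i\<in>UNIV. \<Sum>j\<in>UNIV. \<Sum>l\<in>UNIV. (k *s om + et)$i * (k *s om + et)$j * (k *s om + et)$l * D i j l)"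
      unfolding tri_def sum_2 D' by (simp add: algebra_simps power2_eq_square power3_eq_cube)
    also have "\<dots> = 6 * (A * (- 2 * m$1 * m$2 - 2 * (m$1)^2 * k - 9 * m$2 * k^2 + 2 * m$1 * k^3)) - 6 * (- 3 * A * m$1 * m$2)"
      unfolding eq_diff_eq using j3[of k] unfolding w .
    finally show ?thesis by (simp add: algebra_simps)
  qed
  note coeffs = cubic_coefficients_unique[OF this]
  have tri: "tri et et et = 6 * A * m$1 * m$2" "tri et et om = - 4 * A * (m$1)^2"
    "tri et om om = - 18 * A * m$2" "tri om om om = 12 * A * m$1"
    using coeffs by simp_all
  have "(\<Sum>i\<in>UNIV. \<Sum>j\<in>UNIV. \<Sum>k\<in>UNIV. dperiod c i m X * dperiod c j m Y * dperiod c k m T * D i j k)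
     = X$1 * Y$1 * T$1 * tri et et et + (X$1 * Y$1 * T$2 + X$1 * Y$2 * T$1 + X$2 * Y$1 * T$1) * tri et et om
       + (X$1 * Y$2 * T$2 + X$2 * Y$1 * T$2 + X$2 * Y$2 * T$1) * tri et om om + X$2 * Y$2 * T$2 * tri om om om"
    unfolding tri_def sum_2 D' dp by (simp add: algebra_simps)
  also have "\<dots> = 6 * A * (m$1 * m$2 * (X$1 * Y$1 * T$1)
        - 2 * (m$1)^2 / 3 * (X$1 * Y$1 * T$2 + X$1 * Y$2 * T$1 + X$2 * Y$1 * T$1)
        - 3 * m$2 * (X$1 * Y$2 * T$2 + X$2 * Y$1 * T$2 + X$2 * Y$2 * T$1)
        + 2 * m$1 * (X$2 * Y$2 * T$2))"
    unfolding tri by (simp add: field_simps)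
  also have "6 * A = - (3 * of_real pi * \<i>) / disc m"
    by (simp add: A_def)
  finally show "(\<Sum>i\<in>UNIV. \<Sum>j\<in>UNIV. \<Sum>k\<in>UNIV.
        dperiod c i m X * dperiod c j m Y * dperiod c k m T * J3 J c m i j k)
     = - (3 * of_real pi * \<i>) / disc m *
       (m$1 * m$2 * (X$1 * Y$1 * T$1)
        - 2 * (m$1)^2 / 3 * (X$1 * Y$1 * T$2 + X$1 * Y$2 * T$1 + X$2 * Y$1 * T$1)
        - 3 * m$2 * (X$1 * Y$2 * T$2 + X$2 * Y$1 * T$2 + X$2 * Y$2 * T$1)
        + 2 * m$1 * (X$2 * Y$2 * T$2))"
    unfolding D_def .
qed

section \<open>Comparison with the Frobenius structure\<close>

text \<open>By the Euler relation the Joyce form is the trilinear form with the Euler field in the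
  third slot. The coefficients of \<open>X$1 * Y$1\<close> and \<open>X$2 * Y$2\<close> then cancel,
  and the mixed ones are \<open>- 2 / 15\<close> times the discriminant, which removes the
  denominator.\<close>

lemma g_Joyce_eq_g_Frob:
  assumes J: "A2_Joyce_function J" and pf: "period_frame U c" "m \<in> U"
  shows "g_Joyce J c m X Y = 6 * of_real pi * \<i> / 5 * g_Frob X Y"
proof -
  have disc: "disc m \<noteq> 0"
    using period_frameD(3)[OF pf] pf(2) by (auto simp: base_def)
  define E :: "complex^2" where "E = vector [4 * m$1 / 5, 6 * m$2 / 5]"
  have E: "E$1 = 4 * m$1 / 5" "E$2 = 6 * m$2 / 5" by (simp_all add: E_def)
  have "g_Joyce J c m X Y = (\<Sum>i\<in>UNIV. \<Sum>j\<in>UNIV. \<Sum>k\<in>UNIV.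
        dperiod c i m X * dperiod c j m Y * dperiod c k m E * J3 J c m i j k)"
    unfolding g_Joyce_def period_eq_dperiod_Euler[OF J pf] E_def
    by (simp add: sum_distrib_left mult.assoc)
  also have "\<dots> = - (3 * of_real pi * \<i>) / disc m * (- 2 / 15 * disc m * (X$1 * Y$2 + X$2 * Y$1))"
    unfolding J3_trilinear[OF J pf] E
    by (rule arg_cong[of _ _ "(*) _"]) (simp add: disc_def field_simps power2_eq_square power3_eq_cube)
  also have "\<dots> = 6 * of_real pi * \<i> / 5 * g_Frob X Y"
    using disc by (simp add: g_Frob_def field_simps)
  finally show ?thesis .
qed

lemma g_Frob_nondegenerate:
  assumes "\<And>T. g_Frob V T = g_Frob W T"
  shows "V = W"
  using assms[of "axis 1 1"] assms[of "axis 2 1"]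
  by (simp add: g_Frob_def axis_def vec_eq_iff forall_2)

text \<open>Cramer's rule for multiplication by the Euler field, a 2x2 system with determinant b^2 +
  4a^3/27, that is, the discriminant divided by 27. In the proof \<open>s\<close> and
  \<open>r\<close> are the two components of the Frobenius product of X and Y.\<close>

lemma diamond_Frob_eq:
  assumes "m \<in> base"
  shows "diamond_Frob m X Y = vector
    [27 / disc m * (m$2 * (X$1 * Y$2 + X$2 * Y$1) - 2 * m$1 / 3 * (X$2 * Y$2 - m$1 / 3 * (X$1 * Y$1))),
     27 / disc m * (m$2 * (X$2 * Y$2 - m$1 / 3 * (X$1 * Y$1)) + 2 * (m$1)^2 / 9 * (X$1 * Y$2 + X$2 * Y$1))]"
  (is "_ = ?V")
  unfolding diamond_Frob_def
proof (rule the_equality)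
  define a b where "a = m$1" and "b = m$2"
  have disc: "disc m \<noteq> 0" using assms by (simp add: base_def)
  have D: "disc m = 27 * (b^2 + 4 * a^3 / 27)" by (simp add: disc_def a_def b_def)
  have n: "b^2 + 4 * a^3 / 27 \<noteq> 0" using disc unfolding D by (metis mult_zero_right)
  define s r where "s = X$1 * Y$2 + X$2 * Y$1" and "r = X$2 * Y$2 - a / 3 * (X$1 * Y$1)"
  have mult: "mult_Frob m (E_Frob m) V = mult_Frob m X Y \<longleftrightarrow>
      2 * a / 3 * V$2 + b * V$1 = s \<and> b * V$2 - 2 * a^2 / 9 * V$1 = r" for V
    by (auto simp: mult_Frob_def E_Frob_def vec_eq_iff forall_2 s_def r_def a_def b_def power2_eq_square mult_ac)
  have V: "?V = vector [(b * s - 2 * a / 3 * r) / (b^2 + 4 * a^3 / 27), (b * r + 2 * a^2 / 9 * s) / (b^2 + 4 * a^3 / 27)]"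
  proof -
    have "27 / disc m * x = x / (b^2 + 4 * a^3 / 27)" for x
    proof -
      have "27 / (27 * n) * x = x / n" for n :: complex by simp
      then show ?thesis unfolding D .
    qed
    then show ?thesis by (simp only: s_def r_def a_def b_def)
  qed
  show "mult_Frob m (E_Frob m) ?V = mult_Frob m X Y"
    unfolding V mult vector_2
  proof
    have "2 * a / 3 * (b * r + 2 * a^2 / 9 * s) + b * (b * s - 2 * a / 3 * r) = s * (b^2 + 4 * a^3 / 27)"
      "b * (b * r + 2 * a^2 / 9 * s) - 2 * a^2 / 9 * (b * s - 2 * a / 3 * r) = r * (b^2 + 4 * a^3 / 27)"
      by (simp_all add: field_simps power2_eq_square power3_eq_cube)
    then show "2 * a / 3 * ((b * r + 2 * a^2 / 9 * s) / (b^2 + 4 * a^3 / 27)) + b * ((b * s - 2 * a / 3 * r) / (b^2 + 4 * a^3 / 27)) = s"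
      "b * ((b * r + 2 * a^2 / 9 * s) / (b^2 + 4 * a^3 / 27)) - 2 * a^2 / 9 * ((b * s - 2 * a / 3 * r) / (b^2 + 4 * a^3 / 27)) = r"
      using n by (simp_all only: times_divide_eq_right add_divide_distrib[symmetric] diff_divide_distrib[symmetric]
          nonzero_mult_div_cancel_right not_False_eq_True)
  qed
  fix V assume "mult_Frob m (E_Frob m) V = mult_Frob m X Y"
  then have s: "s = 2 * a / 3 * V$2 + b * V$1" and r: "r = b * V$2 - 2 * a^2 / 9 * V$1"
    unfolding mult by auto
  have "b * s - 2 * a / 3 * r = V$1 * (b^2 + 4 * a^3 / 27)" "b * r + 2 * a^2 / 9 * s = V$2 * (b^2 + 4 * a^3 / 27)"
    unfolding s r by (simp_all add: field_simps power2_eq_square power3_eq_cube)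
  then show "V = ?V"
    unfolding V using n by (simp add: vec_eq_iff forall_2)
qed

text \<open>Non-degeneracy reduces the claim to the defining equation, which is checked on the
  explicit formulas. The constant reflects that each Euler field is the unit of its own diamond
  product and that E is 6/5 times \<open>E_Frob\<close>.\<close>

lemma diamond_Joyce_eq_diamond_Frob:
  assumes J: "A2_Joyce_function J" and pf: "period_frame U c" "m \<in> U"
  shows "diamond_Joyce J c m X Y = (5 / 6) *s diamond_Frob m X Y"
proof -
  have m: "m \<in> base" using period_frameD(3)[OF pf] pf(2) by blast
  then have disc: "disc m \<noteq> 0" by (simp add: base_def)
  have *: "g_Joyce J c m ((5 / 6) *s diamond_Frob m X Y) T = (\<Sum>i\<in>UNIV. \<Sum>j\<in>UNIV. \<Sum>k\<in>UNIV.
        dperiod c i m X * dperiod c j m Y * dperiod c k m T * J3 J c m i j k)" for T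
    unfolding J3_trilinear[OF J pf] g_Joyce_eq_g_Frob[OF J pf] diamond_Frob_eq[OF m] g_Frob_def
    using disc by (simp add: field_simps power2_eq_square)
  show ?thesis
    unfolding diamond_Joyce_def
  proof (rule the_equality)
    fix V assume "\<forall>T. g_Joyce J c m V T = (\<Sum>i\<in>UNIV. \<Sum>j\<in>UNIV. \<Sum>k\<in>UNIV.
        dperiod c i m X * dperiod c j m Y * dperiod c k m T * J3 J c m i j k)"
    then have "g_Joyce J c m V T = g_Joyce J c m ((5 / 6) *s diamond_Frob m X Y) T" for T
      using * by metis
    then show "V = (5 / 6) *s diamond_Frob m X Y"
      unfolding g_Joyce_eq_g_Frob[OF J pf] by (intro g_Frob_nondegenerate) simp
  qed (use * in blast)
qed

theorem theorem10p3:
  fixes J :: "complex^2 \<Rightarrow> ((complex^2) option chain set \<Rightarrow> complex) \<Rightarrow> complex"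
  assumes "A2_Joyce_function J"
  shows "\<exists>l u. l \<noteq> 0 \<and> u \<noteq> 0 \<and>
    (\<forall>X Y. vector_field X \<longrightarrow> vector_field Y \<longrightarrow>
      (\<forall>m\<in>base. \<forall>U c. period_frame U c \<longrightarrow> m \<in> U \<longrightarrow>
         g_Joyce J c m (X m) (Y m) = l * g_Frob (X m) (Y m) \<and>
         g_Joyce_nondegenerate J c m \<and>
         diamond_Joyce J c m (X m) (Y m) = u *s diamond_Frob m (X m) (Y m)))"
proof (rule exI[of _ "6 * of_real pi * \<i> / 5"], rule exI[of _ "5 / 6"], intro conjI allI impI ballI)
  fix X Y :: "complex^2 \<Rightarrow> complex^2" and m U c
  assume pf: "period_frame U c" "m \<in> U"
  show "g_Joyce J c m (X m) (Y m) = 6 * of_real pi * \<i> / 5 * g_Frob (X m) (Y m)"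
    by (rule g_Joyce_eq_g_Frob[OF assms pf])
  show "diamond_Joyce J c m (X m) (Y m) = (5 / 6) *s diamond_Frob m (X m) (Y m)"
    by (rule diamond_Joyce_eq_diamond_Frob[OF assms pf])
  show "g_Joyce_nondegenerate J c m"
    unfolding g_Joyce_nondegenerate_def g_Joyce_eq_g_Frob[OF assms pf]
  proof (intro allI impI)
    fix V assume "\<forall>T. 6 * of_real pi * \<i> / 5 * g_Frob V T = 0"
    then show "V = 0"
      by (intro g_Frob_nondegenerate) (simp add: g_Frob_def)
  qed
qed simp_all

end
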